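(* Let $k,m\ge 2$ be integers. The rank of the monoid $\mathcal{POI}_{k\times m}$ is $2k$.
   Context: The rank of a finite monoid $M$ is the minimum size of a generating set of $M$ (as a monoid). Let $n=km$, $\Omega_n=\{1,\dots,n\}$ and $I_i=\{(i-1)m+1,\dots,im\}$ for $1\le i\le k$. For $x\in\Omega_n$ let $i_x$ denote the index with $x\in I_{i_x}$. $\mathcal{POI}_{k\times m}$ is the monoid, under composition (maps written on the right, composed left to right), of all injective partial maps $\alpha$ from $\Omega_n$ to $\Omega_n$ (the empty map included) such that: (stability) for all $x\in\mathrm{Dom}(\alpha)$, $I_{i_x}\subseteq\mathrm{Dom}(\alpha)$ and $I_{i_x}\alpha=I_{i_{x\alpha}}$; (order preservation) for all $x,y\in\mathrm{Dom}(\alpha)$, $i_x\le i_y$ implies $i_{x\alpha}\le i_{y\alpha}$. *)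

theory Defs
  imports "HOL-Algebra.Group"
begin

definition monoid_span :: "('a, 'b) monoid_scheme \<Rightarrow> 'a set \<Rightarrow> 'a set" where
  "monoid_span M A = \<Inter> {H. submonoid H M \<and> A \<subseteq> H}"

definition generates_monoid :: "('a, 'b) monoid_scheme \<Rightarrow> 'a set \<Rightarrow> bool" where
  "generates_monoid M A \<longleftrightarrow> A \<subseteq> carrier M \<and> monoid_span M A = carrier M"

text \<open>Meaningful only if the monoid is finitely generated, in particular if it is finite.\<close>
definition monoid_rank :: "('a, 'b) monoid_scheme \<Rightarrow> nat" where
  "monoid_rank M = (LEAST r. \<exists>A. finite A \<and> card A = r \<and> generates_monoid M A)"

definition block :: "nat \<Rightarrow> nat \<Rightarrow> nat set" where
  "block m i = {(i - 1) * m + 1..i * m}"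

definition block_index :: "nat \<Rightarrow> nat \<Rightarrow> nat \<Rightarrow> nat" where
  "block_index k m x = (THE i. i \<in> {1..k} \<and> x \<in> block m i)"

definition partial_injections :: "nat \<Rightarrow> (nat \<rightharpoonup> nat) set" where
  "partial_injections n = {\<alpha>. dom \<alpha> \<subseteq> {1..n} \<and> ran \<alpha> \<subseteq> {1..n} \<and> inj_on \<alpha> (dom \<alpha>)}"

definition block_stable :: "nat \<Rightarrow> nat \<Rightarrow> (nat \<rightharpoonup> nat) \<Rightarrow> bool" where
  "block_stable k m \<alpha> \<longleftrightarrow>
     (\<forall>x \<in> dom \<alpha>. block m (block_index k m x) \<subseteq> dom \<alpha> \<and>
        (\<lambda>y. the (\<alpha> y)) ` block m (block_index k m x) = block m (block_index k m (the (\<alpha> x))))"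

definition block_order_preserving :: "nat \<Rightarrow> nat \<Rightarrow> (nat \<rightharpoonup> nat) \<Rightarrow> bool" where
  "block_order_preserving k m \<alpha> \<longleftrightarrow>
     (\<forall>x \<in> dom \<alpha>. \<forall>y \<in> dom \<alpha>. block_index k m x \<le> block_index k m y \<longrightarrow>
        block_index k m (the (\<alpha> x)) \<le> block_index k m (the (\<alpha> y)))"

text \<open>Maps act on the right: the product of \<open>\<alpha>\<close> and \<open>\<beta>\<close> applies \<open>\<alpha>\<close> first, so it is
  \<open>\<beta> \<circ>\<^sub>m \<alpha>\<close>. The identity is the identity map on \<open>{1..k * m}\<close>, undefined elsewhere.\<close>
definition POI :: "nat \<Rightarrow> nat \<Rightarrow> (nat \<rightharpoonup> nat) monoid" where
  "POI k m = \<lparr>carrier = {\<alpha> \<in> partial_injections (k * m).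
                  block_stable k m \<alpha> \<and> block_order_preserving k m \<alpha>},
     monoid.mult = (\<lambda>\<alpha> \<beta>. \<beta> \<circ>\<^sub>m \<alpha>),
     one = (\<lambda>x. if x \<in> {1..k * m} then Some x else None)\<rparr>"

lemma block_disjoint:
  assumes "x \<in> block m i" "x \<in> block m j"
  shows "i = j"
proof -
  have *: False if "x \<in> block m i" "x \<in> block m j" "i < j" for i j
  proof -
    have "i * m \<le> (j - 1) * m" using that(3) by (intro mult_right_mono) auto
    then show False using that unfolding block_def atLeastAtMost_iff by linarith
  qed
  show ?thesis using * assms by (metis linorder_neqE_nat)
qed

lemma block_index_eqI: "i \<in> {1..k} \<Longrightarrow> x \<in> block m i \<Longrightarrow> block_index k m x = i"
  unfolding block_index_def by (rule the_equality) (auto dest: block_disjoint)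

lemma block_exists:
  assumes "x \<in> {1..k * m}"
  shows "\<exists>i \<in> {1..k}. x \<in> block m i"
proof -
  have m: "m > 0" using assms by (cases m) auto
  let ?q = "(x - 1) div m"
  have x: "x - 1 = ?q * m + (x - 1) mod m" by simp
  have r: "(x - 1) mod m < m" using m by simp
  have "x - 1 < k * m" using assms by auto
  then have "?q < k" by (simp add: less_mult_imp_div_less)
  moreover have "x \<in> block m (?q + 1)"
  proof -
    have "1 \<le> x" "(?q + 1) * m = ?q * m + m" using assms by auto
    then show ?thesis
      using x r unfolding block_def atLeastAtMost_iff add_diff_cancel_right' by linarith
  qed
  ultimately show ?thesis by (intro bexI[of _ "?q + 1"]) auto
qed

lemma block_index_mem:
  assumes "x \<in> {1..k * m}"
  shows "block_index k m x \<in> {1..k}" "x \<in> block m (block_index k m x)"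
  using block_exists[OF assms] block_index_eqI by metis+

lemma finite_POI: "finite (carrier (POI k m))"
proof (rule finite_subset)
  let ?F = "{\<alpha> :: nat \<rightharpoonup> nat. dom \<alpha> \<subseteq> {1..k * m} \<and> ran \<alpha> \<subseteq> {1..k * m}}"
  show "carrier (POI k m) \<subseteq> ?F" by (auto simp: POI_def partial_injections_def)
  have "?F = (\<Union>D \<in> Pow {1..k * m}. {\<alpha>. dom \<alpha> = D \<and> ran \<alpha> \<subseteq> {1..k * m}})" by auto
  moreover have "finite \<dots>"
    by (intro finite_UN_I finite_set_of_finite_maps) (auto intro: finite_subset)
  ultimately show "finite ?F" by simp
qed

lemma monoid_POI: "monoid (POI k m)"
proof (rule monoidI)
  show "\<one>\<^bsub>POI k m\<^esub> \<in> carrier (POI k m)"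
  proof -
    have d: "dom \<one>\<^bsub>POI k m\<^esub> = {1..k * m}" by (auto simp: POI_def split: if_splits)
    have v: "\<one>\<^bsub>POI k m\<^esub> x = Some x" if "x \<in> {1..k * m}" for x using that by (simp add: POI_def)
    have b: "block m (block_index k m x) \<subseteq> {1..k * m}" if "x \<in> {1..k * m}" for x
    proof -
      have "block_index k m x * m \<le> k * m"
        using block_index_mem(1)[OF that] by (intro mult_right_mono) auto
      then show ?thesis by (auto simp: block_def)
    qed
    have "\<one>\<^bsub>POI k m\<^esub> \<in> partial_injections (k * m)"
      unfolding partial_injections_def
      by (auto simp: POI_def ran_def inj_on_def split: if_splits)
    moreover have "block_stable k m \<one>\<^bsub>POI k m\<^esub>"
      unfolding block_stable_def d
    proof (intro ballI conjI)
      fix x assume x: "x \<in> {1..k * m}"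
      show "block m (block_index k m x) \<subseteq> {1..k * m}" using b[OF x] .
      have "(\<lambda>y. the (\<one>\<^bsub>POI k m\<^esub> y)) ` block m (block_index k m x)
          = (\<lambda>y. y) ` block m (block_index k m x)"
        using b[OF x] v by (intro image_cong) auto
      then show "(\<lambda>y. the (\<one>\<^bsub>POI k m\<^esub> y)) ` block m (block_index k m x)
          = block m (block_index k m (the (\<one>\<^bsub>POI k m\<^esub> x)))"
        using v[OF x] by simp
    qed
    moreover have "block_order_preserving k m \<one>\<^bsub>POI k m\<^esub>"
      unfolding block_order_preserving_def d using v by simp
    ultimately show ?thesis by (simp add: POI_def)
  qed
next
  fix \<alpha> \<beta> assume "\<alpha> \<in> carrier (POI k m)" "\<beta> \<in> carrier (POI k m)"
  then have
    a: "\<alpha> \<in> partial_injections (k * m)" "block_stable k m \<alpha>" "block_order_preserving k m \<alpha>" and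
    b: "\<beta> \<in> partial_injections (k * m)" "block_stable k m \<beta>" "block_order_preserving k m \<beta>"
    by (auto simp: POI_def)
  have ex: "\<exists>y z. \<alpha> x = Some y \<and> \<beta> y = Some z \<and> (\<beta> \<circ>\<^sub>m \<alpha>) x = Some z"
    if "x \<in> dom (\<beta> \<circ>\<^sub>m \<alpha>)" for x
    using that by (auto simp: map_comp_def split: option.splits)
  have "\<beta> \<circ>\<^sub>m \<alpha> \<in> partial_injections (k * m)"
  proof -
    have "dom (\<beta> \<circ>\<^sub>m \<alpha>) \<subseteq> {1..k * m}"
      using a(1) ex by (fastforce simp: partial_injections_def)
    moreover have "ran (\<beta> \<circ>\<^sub>m \<alpha>) \<subseteq> {1..k * m}"
      using b(1) by (fastforce simp: partial_injections_def ran_def map_comp_Some_iff)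
    moreover have "inj_on (\<beta> \<circ>\<^sub>m \<alpha>) (dom (\<beta> \<circ>\<^sub>m \<alpha>))"
    proof (rule inj_onI)
      fix x x' assume x: "x \<in> dom (\<beta> \<circ>\<^sub>m \<alpha>)" "x' \<in> dom (\<beta> \<circ>\<^sub>m \<alpha>)"
        and eq: "(\<beta> \<circ>\<^sub>m \<alpha>) x = (\<beta> \<circ>\<^sub>m \<alpha>) x'"
      obtain y z where 1: "\<alpha> x = Some y" "\<beta> y = Some z" "(\<beta> \<circ>\<^sub>m \<alpha>) x = Some z"
        using ex[OF x(1)] by blast
      obtain y' z' where 2: "\<alpha> x' = Some y'" "\<beta> y' = Some z'" "(\<beta> \<circ>\<^sub>m \<alpha>) x' = Some z'"
        using ex[OF x(2)] by blast
      have "y = y'" using b(1) 1 2 eq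
        unfolding partial_injections_def inj_on_def by (metis (mono_tags, lifting) domI mem_Collect_eq)
      then show "x = x'" using a(1) 1 2
        unfolding partial_injections_def inj_on_def by (metis (mono_tags, lifting) domI mem_Collect_eq)
    qed
    ultimately show ?thesis by (simp add: partial_injections_def)
  qed
  moreover have "block_stable k m (\<beta> \<circ>\<^sub>m \<alpha>)"
    unfolding block_stable_def
  proof (intro ballI)
    fix x assume "x \<in> dom (\<beta> \<circ>\<^sub>m \<alpha>)"
    then obtain y z where 1: "\<alpha> x = Some y" "\<beta> y = Some z" "(\<beta> \<circ>\<^sub>m \<alpha>) x = Some z"
      using ex by blast
    let ?I = "block m (block_index k m x)" and ?J = "block m (block_index k m y)"
    have A: "?I \<subseteq> dom \<alpha>" "(\<lambda>y. the (\<alpha> y)) ` ?I = ?J"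
      using a(2)[unfolded block_stable_def, rule_format, of x] 1(1) by auto
    have B: "?J \<subseteq> dom \<beta>" "(\<lambda>y. the (\<beta> y)) ` ?J = block m (block_index k m z)"
      using b(2)[unfolded block_stable_def, rule_format, of y] 1(2) by auto
    have C: "(\<beta> \<circ>\<^sub>m \<alpha>) u = \<beta> (the (\<alpha> u))" "the (\<alpha> u) \<in> dom \<beta>" if "u \<in> ?I" for u
      using that A B(1) by (auto simp: map_comp_def)
    have "?I \<subseteq> dom (\<beta> \<circ>\<^sub>m \<alpha>)" using C by (metis domIff subsetI)
    moreover have "(\<lambda>y. the ((\<beta> \<circ>\<^sub>m \<alpha>) y)) ` ?I = (\<lambda>y. the (\<beta> y)) ` ((\<lambda>y. the (\<alpha> y)) ` ?I)"
      unfolding image_image by (intro image_cong) (simp_all add: C)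
    ultimately show "?I \<subseteq> dom (\<beta> \<circ>\<^sub>m \<alpha>) \<and>
        (\<lambda>y. the ((\<beta> \<circ>\<^sub>m \<alpha>) y)) ` ?I = block m (block_index k m (the ((\<beta> \<circ>\<^sub>m \<alpha>) x)))"
      using A B 1 by simp
  qed
  moreover have "block_order_preserving k m (\<beta> \<circ>\<^sub>m \<alpha>)"
    unfolding block_order_preserving_def
  proof (intro ballI impI)
    fix x x' assume x: "x \<in> dom (\<beta> \<circ>\<^sub>m \<alpha>)" "x' \<in> dom (\<beta> \<circ>\<^sub>m \<alpha>)"
      and le: "block_index k m x \<le> block_index k m x'"
    obtain y z where 1: "\<alpha> x = Some y" "\<beta> y = Some z" "(\<beta> \<circ>\<^sub>m \<alpha>) x = Some z"
      using ex[OF x(1)] by blast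
    obtain y' z' where 2: "\<alpha> x' = Some y'" "\<beta> y' = Some z'" "(\<beta> \<circ>\<^sub>m \<alpha>) x' = Some z'"
      using ex[OF x(2)] by blast
    have "block_index k m y \<le> block_index k m y'"
      using a(3) 1 2 le unfolding block_order_preserving_def by (metis domI option.sel)
    then have "block_index k m z \<le> block_index k m z'"
      using b(3) 1 2 unfolding block_order_preserving_def by (metis domI option.sel)
    then show "block_index k m (the ((\<beta> \<circ>\<^sub>m \<alpha>) x)) \<le> block_index k m (the ((\<beta> \<circ>\<^sub>m \<alpha>) x'))"
      using 1 2 by simp
  qed
  ultimately show "\<alpha> \<otimes>\<^bsub>POI k m\<^esub> \<beta> \<in> carrier (POI k m)" by (simp add: POI_def)
next
  fix \<alpha> \<beta> \<gamma>
  show "\<alpha> \<otimes>\<^bsub>POI k m\<^esub> \<beta> \<otimes>\<^bsub>POI k m\<^esub> \<gamma> = \<alpha> \<otimes>\<^bsub>POI k m\<^esub> (\<beta> \<otimes>\<^bsub>POI k m\<^esub> \<gamma>)"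
    by (auto simp: POI_def map_comp_def fun_eq_iff split: option.splits)
next
  fix \<alpha> assume "\<alpha> \<in> carrier (POI k m)"
  then have s: "x \<in> {1..k * m}" "y \<in> {1..k * m}" if "\<alpha> x = Some y" for x y
    using that by (auto simp: POI_def partial_injections_def ran_def dom_def)
  show "\<one>\<^bsub>POI k m\<^esub> \<otimes>\<^bsub>POI k m\<^esub> \<alpha> = \<alpha>"
  proof
    fix x show "(\<one>\<^bsub>POI k m\<^esub> \<otimes>\<^bsub>POI k m\<^esub> \<alpha>) x = \<alpha> x"
      using s(1)[of x] by (cases "\<alpha> x") (auto simp: POI_def map_comp_def)
  qed
  show "\<alpha> \<otimes>\<^bsub>POI k m\<^esub> \<one>\<^bsub>POI k m\<^esub> = \<alpha>"
  proof
    fix x show "(\<alpha> \<otimes>\<^bsub>POI k m\<^esub> \<one>\<^bsub>POI k m\<^esub>) x = \<alpha> x"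
      using s(2)[of x] by (cases "\<alpha> x") (auto simp: POI_def map_comp_def)
  qed
qed

end

theory Submission
  imports Defs "HOL-Combinatorics.Permutations"
begin

text \<open>
  The monoid is the wreath product of the symmetric group \<open>S\<^sub>m\<close> with the monoid of order-preserving
  partial injections of the \<open>k\<close> blocks; its group of units is \<open>(S\<^sub>m)\<^sup>k\<close>.

  Lower bound. A product is a unit only if all its factors are, so the units of a generating set
  generate \<open>(S\<^sub>m)\<^sup>k\<close>; passing to signs, they generate \<open>(\<int>/2)\<^sup>k\<close>, hence there are at least \<open>k\<close> of
  them. If a product misses exactly block \<open>i\<close> in its domain, then so does its first factor that is
  not a unit; this gives \<open>k\<close> further generators.

  Upper bound. Let \<open>t\<^sub>i\<close> be a transposition and \<open>c\<^sub>i\<close> a cycle of odd length that generate the symmetric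
  group on block \<open>i\<close>. As \<open>t\<^sub>i\<close> and \<open>c\<^sub>j\<close> commute and have coprime orders for \<open>i \<noteq> j\<close>, the \<open>k\<close> products
  \<open>t\<^sub>i c\<^sub>i\<^sub>+\<^sub>1\<close> (indices mod \<open>k\<close>) generate all units. The order isomorphisms \<open>rook i j\<close> from the blocks
  other than \<open>i\<close> onto the blocks other than \<open>j\<close> satisfy \<open>(i, j) (j, l) = (i, l)\<close>, so the \<open>k\<close> rooks
  \<open>(i, i + 1)\<close> generate them all. Finally, an element that moves some block can be brought closer to
  one that fixes all blocks by multiplying it with a rook, which another rook undoes; and an element
  that fixes the blocks of its domain is a unit times idempotents \<open>(i, i)\<close>.
\<close>

subsection \<open>Block coordinates\<close>

text \<open>Block index counted from 0, as points start at 1. The point 0 gets index 0 by truncated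
  subtraction, so statements about blocks also need \<open>1 \<le> x\<close>.\<close>

definition blk :: "nat \<Rightarrow> nat \<Rightarrow> nat" where
  "blk m x = (x - 1) div m"

lemma mem_block_Suc_iff:
  assumes "m > 0"
  shows "y \<in> block m (Suc q) \<longleftrightarrow> 1 \<le> y \<and> blk m y = q"
proof -
  have "blk m y = q \<longleftrightarrow> q * m \<le> y - 1 \<and> y - 1 < Suc q * m"
  proof
    assume "q * m \<le> y - 1 \<and> y - 1 < Suc q * m"
    then show "blk m y = q" unfolding blk_def by (intro div_nat_eqI) (auto simp: mult.commute)
  next
    assume "blk m y = q"
    then have "y - 1 = q * m + (y - 1) mod m"
      unfolding blk_def using div_mult_mod_eq[of "y - 1" m] by simp
    moreover have "(y - 1) mod m < m" using assms by simp
    ultimately show "q * m \<le> y - 1 \<and> y - 1 < Suc q * m" unfolding mult_Suc by linarith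
  qed
  moreover have "y \<in> block m (Suc q) \<longleftrightarrow> 1 \<le> y \<and> q * m \<le> y - 1 \<and> y - 1 < Suc q * m"
    unfolding block_def mult_Suc by auto
  ultimately show ?thesis by blast
qed

lemma blk_less: "x \<in> {1..k * m} \<Longrightarrow> blk m x < k"
  unfolding blk_def by (auto intro!: less_mult_imp_div_less)

lemma block_index_eq_blk:
  assumes "x \<in> {1..k * m}"
  shows "block_index k m x = Suc (blk m x)"
proof -
  have "m > 0" using assms by (cases m) auto
  then show ?thesis using assms blk_less[OF assms]
    by (intro block_index_eqI) (auto simp: mem_block_Suc_iff)
qed

lemma block_subset: "q < k \<Longrightarrow> block m (Suc q) \<subseteq> {1..k * m}"
proof -
  assume "q < k"
  then have "Suc q * m \<le> k * m" by (intro mult_right_mono) auto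
  then show ?thesis by (auto simp: block_def)
qed

lemma card_block: "card (block m (Suc q)) = m"
  by (simp add: block_def)

section \<open>Membership criterion and its converses in block coordinates\<close>

text \<open>Half of stability comes for free: by monotonicity in both directions a block is sent
  into a single block, and injectivity with equal cardinalities makes it onto.\<close>

lemma POI_memI:
  assumes m: "m > 0"
    and rng: "\<And>x y. \<alpha> x = Some y \<Longrightarrow> x \<in> {1..k * m} \<and> y \<in> {1..k * m}"
    and inj: "\<And>x x' y. \<alpha> x = Some y \<Longrightarrow> \<alpha> x' = Some y \<Longrightarrow> x = x'"
    and closed: "\<And>x y x'. \<alpha> x = Some y \<Longrightarrow> x' \<in> {1..k * m} \<Longrightarrow> blk m x' = blk m x
      \<Longrightarrow> \<exists>y'. \<alpha> x' = Some y'"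
    and mono: "\<And>x x' y y'. \<alpha> x = Some y \<Longrightarrow> \<alpha> x' = Some y' \<Longrightarrow> blk m x \<le> blk m x'
      \<Longrightarrow> blk m y \<le> blk m y'"
  shows "\<alpha> \<in> carrier (POI k m)"
proof -
  have "\<alpha> \<in> partial_injections (k * m)"
    using rng inj by (fastforce simp: partial_injections_def ran_def inj_on_def)
  moreover have "block_order_preserving k m \<alpha>"
    unfolding block_order_preserving_def
  proof safe
    fix x x' y y' assume "\<alpha> x = Some y" "\<alpha> x' = Some y'" "block_index k m x \<le> block_index k m x'"
    then show "block_index k m (the (\<alpha> x)) \<le> block_index k m (the (\<alpha> x'))"
      using rng[of x y] rng[of x' y'] mono[of x y x' y'] by (simp add: block_index_eq_blk)
  qed
  moreover have "block_stable k m \<alpha>"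
    unfolding block_stable_def
  proof (intro ballI conjI subsetI)
    fix x z assume "x \<in> dom \<alpha>" and z: "z \<in> block m (block_index k m x)"
    then obtain y where xy: "\<alpha> x = Some y" by blast
    have x: "x \<in> {1..k * m}" using rng[OF xy] by simp
    have "z \<in> block m (Suc (blk m x))" using z x by (simp add: block_index_eq_blk)
    then have "z \<in> {1..k * m}" "blk m z = blk m x"
      using block_subset[OF blk_less[OF x]] m by (blast, simp add: mem_block_Suc_iff)
    then show "z \<in> dom \<alpha>" using closed[OF xy] by blast
  next
    fix x assume "x \<in> dom \<alpha>"
    then obtain y where xy: "\<alpha> x = Some y" by blast
    have x: "x \<in> {1..k * m}" and y: "y \<in> {1..k * m}" using rng[OF xy] by simp_all
    let ?I = "block m (Suc (blk m x))" and ?J = "block m (Suc (blk m y))"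
    let ?f = "\<lambda>z. the (\<alpha> z)"
    have I: "z \<in> {1..k * m} \<and> blk m z = blk m x" if "z \<in> ?I" for z
      using that block_subset[OF blk_less[OF x]] m mem_block_Suc_iff by blast
    have def: "\<exists>z'. \<alpha> z = Some z'" if "z \<in> ?I" for z using I[OF that] closed[OF xy] by blast
    have sub: "?f ` ?I \<subseteq> ?J"
    proof safe
      fix z assume z: "z \<in> ?I"
      then obtain z' where z': "\<alpha> z = Some z'" using def by blast
      have "blk m z' = blk m y"
        using mono[OF xy z'] mono[OF z' xy] I[OF z] by (intro antisym) auto
      then show "?f z \<in> ?J" using rng[OF z'] z' m by (auto simp: mem_block_Suc_iff)
    qed
    have "inj_on ?f ?I"
      by (rule inj_onI) (metis def inj option.sel)
    then have "card (?f ` ?I) = card ?J" by (simp add: card_image card_block)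
    then have "?f ` ?I = ?J" using sub by (intro card_subset_eq) (auto simp: block_def)
    then show "(\<lambda>y. the (\<alpha> y)) ` block m (block_index k m x) = block m (block_index k m (the (\<alpha> x)))"
      using x y xy by (simp add: block_index_eq_blk)
  qed
  ultimately show ?thesis by (simp add: POI_def)
qed

lemma POI_rng:
  assumes "\<alpha> \<in> carrier (POI k m)" "\<alpha> x = Some y"
  shows "x \<in> {1..k * m}" "y \<in> {1..k * m}"
  using assms unfolding POI_def partial_injections_def by (auto simp: ran_def dom_def)

lemma POI_inj:
  assumes "\<alpha> \<in> carrier (POI k m)" "\<alpha> x = Some y" "\<alpha> x' = Some y"
  shows "x = x'"
proof -
  have "inj_on \<alpha> (dom \<alpha>)" using assms(1) unfolding POI_def partial_injections_def by auto
  then show ?thesis using assms(2,3) by (metis domI inj_onD)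
qed

lemma POI_closed:
  assumes "\<alpha> \<in> carrier (POI k m)" "\<alpha> x = Some y" "x' \<in> {1..k * m}" "blk m x' = blk m x"
  shows "\<exists>y'. \<alpha> x' = Some y'"
proof -
  have m: "m > 0" using assms(3) by (cases m) auto
  have "block m (block_index k m x) \<subseteq> dom \<alpha>"
    using assms(1,2) unfolding POI_def block_stable_def by auto
  then show ?thesis using assms(3,4) POI_rng(1)[OF assms(1,2)] m
    by (auto simp: block_index_eq_blk mem_block_Suc_iff)
qed

lemma POI_mono:
  assumes "\<alpha> \<in> carrier (POI k m)" "\<alpha> x = Some y" "\<alpha> x' = Some y'" "blk m x \<le> blk m x'"
  shows "blk m y \<le> blk m y'"
proof -
  have "\<forall>x \<in> dom \<alpha>. \<forall>y \<in> dom \<alpha>. block_index k m x \<le> block_index k m y \<longrightarrow>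
      block_index k m (the (\<alpha> x)) \<le> block_index k m (the (\<alpha> y))"
    using assms(1) unfolding POI_def block_order_preserving_def by auto
  moreover have "x \<in> dom \<alpha>" "x' \<in> dom \<alpha>" "block_index k m x \<le> block_index k m x'"
    using assms POI_rng[OF assms(1,2)] POI_rng[OF assms(1,3)]
    by (auto simp: block_index_eq_blk)
  ultimately have "block_index k m (the (\<alpha> x)) \<le> block_index k m (the (\<alpha> x'))" by blast
  then show ?thesis using assms POI_rng[OF assms(1,2)] POI_rng[OF assms(1,3)]
    by (simp add: block_index_eq_blk)
qed

lemma POI_range_closed:
  assumes "\<alpha> \<in> carrier (POI k m)" "\<alpha> x = Some y" "y' \<in> {1..k * m}" "blk m y' = blk m y"
  shows "\<exists>x'. \<alpha> x' = Some y' \<and> blk m x' = blk m x"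
proof -
  have m: "m > 0" using assms(3) by (cases m) auto
  note x = POI_rng[OF assms(1,2)]
  have st: "block m (block_index k m x) \<subseteq> dom \<alpha>"
    "(\<lambda>y. the (\<alpha> y)) ` block m (block_index k m x) = block m (block_index k m (the (\<alpha> x)))"
    using assms(1) domI[of \<alpha>, OF assms(2)] unfolding POI_def block_stable_def by auto
  have "y' \<in> (\<lambda>y. the (\<alpha> y)) ` block m (Suc (blk m x))"
    using st(2) assms(2-4) x m by (auto simp: block_index_eq_blk mem_block_Suc_iff)
  then obtain x' where x': "x' \<in> block m (Suc (blk m x))" "y' = the (\<alpha> x')" by auto
  then show ?thesis using st(1) x m
    by (intro exI[of _ x']) (auto simp: block_index_eq_blk mem_block_Suc_iff)
qed

text \<open>If \<open>x'\<close> lay in an earlier block than \<open>x\<close>, monotonicity would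
  put \<open>y\<close> and \<open>y'\<close> in one block. That block is the image of the block of
  \<open>x'\<close>, so \<open>y\<close> would have a second preimage there.\<close>

lemma POI_reflect:
  assumes "\<alpha> \<in> carrier (POI k m)" "\<alpha> x = Some y" "\<alpha> x' = Some y'" "blk m y \<le> blk m y'"
  shows "blk m x \<le> blk m x'"
proof (rule ccontr)
  assume "\<not> ?thesis"
  then have lt: "blk m x' < blk m x" by simp
  then have "blk m y = blk m y'" using POI_mono[OF assms(1,3,2)] assms(4) by simp
  then obtain x'' where "\<alpha> x'' = Some y" "blk m x'' = blk m x'"
    using POI_range_closed[OF assms(1,3)] POI_rng[OF assms(1,2)] by metis
  then show False using POI_inj[OF assms(1,2)] lt by auto
qed

text \<open>If \<open>\<alpha>\<close> moves a block up, then the least such block can be moved one step back without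
  collision; dually for the greatest block moved down.\<close>

lemma POI_free_neighbour:
  assumes \<alpha>: "\<alpha> \<in> carrier (POI k m)" and "\<alpha> x0 = Some y0" "blk m x0 \<noteq> blk m y0"
  shows "\<exists>x y j. \<alpha> x = Some y \<and> j < k \<and> (j = Suc (blk m y) \<or> blk m y = Suc j)
    \<and> \<bar>int j - int (blk m x)\<bar> < \<bar>int (blk m y) - int (blk m x)\<bar>
    \<and> (\<forall>x' y'. \<alpha> x' = Some y' \<longrightarrow> blk m y' \<noteq> j)"
proof -
  consider "blk m x0 < blk m y0" | "blk m y0 < blk m x0" using assms(3) by linarith
  then show ?thesis
  proof cases
    case 1
    define P where "P q \<longleftrightarrow> (\<exists>x y. \<alpha> x = Some y \<and> blk m x = q \<and> q < blk m y)" for q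
    have "P (blk m x0)" using 1 assms(2) by (auto simp: P_def)
    then have "P (LEAST q. P q)" by (rule LeastI)
    then obtain x y where xy: "\<alpha> x = Some y" "blk m x = (LEAST q. P q)" "blk m x < blk m y"
      by (auto simp: P_def)
    define j where "j = blk m y - 1"
    \<comment> \<open>A point sent into \<open>j\<close> comes from an earlier block by
      monotonicity; since \<open>blk m x \<le> j\<close>, it is itself moved up, against
      minimality.\<close>
    have "blk m y' \<noteq> j" if "\<alpha> x' = Some y'" for x' y'
    proof
      assume j: "blk m y' = j"
      then have "blk m y' < blk m y" using xy(3) j_def by simp
      then have lt: "blk m x' < blk m x" using POI_mono[OF \<alpha> xy(1) that] by (meson not_le)
      then have "blk m x' < blk m y'" using j j_def xy(3) by simp
      then have "P (blk m x')" using that by (auto simp: P_def)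
      then show False using lt xy(2) not_less_Least by metis
    qed
    moreover have "j < k" using blk_less[OF POI_rng(2)[OF \<alpha> xy(1)]] by (simp add: j_def)
    ultimately show ?thesis using xy
      by (intro exI[of _ x] exI[of _ y] exI[of _ j]) (auto simp: j_def)
  next
    case 2
    define P where "P q \<longleftrightarrow> (\<exists>x y. \<alpha> x = Some y \<and> blk m x = q \<and> q > blk m y)" for q
    have P: "P (blk m x0)" using 2 assms(2) by (auto simp: P_def)
    have bd: "q \<le> k" if "P q" for q
      using that blk_less[OF POI_rng(1)[OF \<alpha>]] less_imp_le unfolding P_def by metis
    have "P (GREATEST q. P q)" using P bd by (rule GreatestI_nat)
    then obtain x y where xy: "\<alpha> x = Some y" "blk m x = (GREATEST q. P q)" "blk m x > blk m y"
      by (auto simp: P_def)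
    define j where "j = Suc (blk m y)"
    have "blk m y' \<noteq> j" if "\<alpha> x' = Some y'" for x' y'
    proof
      assume j: "blk m y' = j"
      then have "blk m y < blk m y'" using xy(3) j_def by simp
      then have lt: "blk m x < blk m x'" using POI_mono[OF \<alpha> that xy(1)] by (meson not_le)
      then have "blk m x' > blk m y'" using j j_def xy(3) by simp
      then have "P (blk m x')" using that by (auto simp: P_def)
      then have "blk m x' \<le> (GREATEST q. P q)" using bd by (rule Greatest_le_nat)
      then show False using lt xy(2) by simp
    qed
    moreover have "j < k" using blk_less[OF POI_rng(1)[OF \<alpha> xy(1)]] xy(3) by (simp add: j_def)
    ultimately show ?thesis using xy
      by (intro exI[of _ x] exI[of _ y] exI[of _ j]) (auto simp: j_def)
  qed
qed

subsection \<open>Generation from units and rooks\<close>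

lemma POI_mult: "\<alpha> \<otimes>\<^bsub>POI k m\<^esub> \<beta> = \<beta> \<circ>\<^sub>m \<alpha>"
  by (simp add: POI_def)

definition emb :: "nat \<Rightarrow> (nat \<Rightarrow> nat) \<Rightarrow> (nat \<rightharpoonup> nat)" where
  "emb n p = (\<lambda>x. if x \<in> {1..n} then Some (p x) else None)"

lemma emb_Some_iff: "emb n p x = Some y \<longleftrightarrow> x \<in> {1..n} \<and> y = p x"
  by (auto simp: emb_def)

lemma one_POI: "\<one>\<^bsub>POI k m\<^esub> = emb (k * m) id"
  by (simp add: POI_def emb_def fun_eq_iff)

lemma emb_mult:
  assumes "p permutes {1..k * m}"
  shows "emb (k * m) p \<otimes>\<^bsub>POI k m\<^esub> emb (k * m) q = emb (k * m) (q \<circ> p)"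
proof
  fix x
  show "(emb (k * m) p \<otimes>\<^bsub>POI k m\<^esub> emb (k * m) q) x = emb (k * m) (q \<circ> p) x"
    using permutes_in_image[OF assms, of x]
    by (cases "x \<in> {1..k * m}") (simp_all add: POI_mult map_comp_def emb_def)
qed

text \<open>Under \<open>emb\<close> these permutations become exactly the units of the
  monoid.\<close>

definition block_perm :: "nat \<Rightarrow> nat \<Rightarrow> (nat \<Rightarrow> nat) \<Rightarrow> bool" where
  "block_perm k m p \<longleftrightarrow> p permutes {1..k * m} \<and> (\<forall>x. blk m (p x) = blk m x)"

lemma block_perm_id: "block_perm k m id"
  by (simp add: block_perm_def permutes_id)

lemma block_perm_comp: "block_perm k m p \<Longrightarrow> block_perm k m q \<Longrightarrow> block_perm k m (q \<circ> p)"
  by (simp add: block_perm_def permutes_compose)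

lemma block_perm_transpose:
  assumes "x \<in> {1..k * m}" "y \<in> {1..k * m}" "blk m x = blk m y"
  shows "block_perm k m (transpose x y)"
  using assms permutes_swap_id[OF assms(1,2)] by (auto simp: block_perm_def transpose_def)

lemma emb_in_POI:
  assumes "m > 0" "block_perm k m p"
  shows "emb (k * m) p \<in> carrier (POI k m)"
proof -
  have p: "p permutes {1..k * m}" "\<And>x. blk m (p x) = blk m x"
    using assms(2) by (auto simp: block_perm_def)
  show ?thesis
  proof (rule POI_memI[OF assms(1)])
    fix x y assume "emb (k * m) p x = Some y"
    then show "x \<in> {1..k * m} \<and> y \<in> {1..k * m}"
      using permutes_in_image[OF p(1), of x] by (simp add: emb_Some_iff)
  next
    fix x x' y assume "emb (k * m) p x = Some y" "emb (k * m) p x' = Some y"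
    then show "x = x'" using permutes_inj[OF p(1)] by (auto simp: emb_Some_iff dest: injD)
  qed (auto simp: emb_Some_iff p(2))
qed

section \<open>Lifting partial maps of block indices\<close>

text \<open>Whole blocks move by \<open>f\<close> while the offset \<open>(x - 1) mod m\<close> is
  kept: the canonical copy of the quotient inside the wreath product.\<close>

definition block_lift :: "nat \<Rightarrow> nat \<Rightarrow> (nat \<rightharpoonup> nat) \<Rightarrow> (nat \<rightharpoonup> nat)" where
  "block_lift k m f = (\<lambda>x. if x \<in> {1..k * m}
     then map_option (\<lambda>q. Suc (q * m + (x - 1) mod m)) (f (blk m x)) else None)"

lemma blk_point: "m > 0 \<Longrightarrow> blk m (Suc (q * m + x mod m)) = q"
  by (simp add: blk_def)

lemma point_less: "q < k \<Longrightarrow> m > 0 \<Longrightarrow> Suc (q * m + x mod m) \<in> {1..k * m}"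
proof -
  assume q: "q < k" and "m > 0"
  then have "x mod m < m" by simp
  moreover have "Suc q * m \<le> k * m" using q by (intro mult_right_mono) auto
  ultimately show ?thesis by simp
qed

lemma point_blk: "x \<ge> 1 \<Longrightarrow> Suc (blk m x * m + (x - 1) mod m) = x"
  unfolding blk_def using div_mult_mod_eq[of "x - 1" m] by linarith

lemma block_lift_Some_iff:
  "block_lift k m f x = Some y \<longleftrightarrow>
     x \<in> {1..k * m} \<and> (\<exists>q. f (blk m x) = Some q \<and> y = Suc (q * m + (x - 1) mod m))"
  by (auto simp: block_lift_def)

lemma block_lift_in_POI:
  assumes m: "m > 0"
    and rng: "\<And>q q'. q < k \<Longrightarrow> f q = Some q' \<Longrightarrow> q' < k"
    and inj: "\<And>p q r. f p = Some r \<Longrightarrow> f q = Some r \<Longrightarrow> p = q"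
    and mono: "\<And>p q p' q'. f p = Some p' \<Longrightarrow> f q = Some q' \<Longrightarrow> p \<le> q \<Longrightarrow> p' \<le> q'"
  shows "block_lift k m f \<in> carrier (POI k m)"
proof (rule POI_memI[OF m])
  fix x y assume "block_lift k m f x = Some y"
  then obtain q where q: "x \<in> {1..k * m}" "f (blk m x) = Some q" "y = Suc (q * m + (x - 1) mod m)"
    by (auto simp: block_lift_Some_iff)
  then show "x \<in> {1..k * m} \<and> y \<in> {1..k * m}"
    using rng[OF blk_less q(2)] point_less[OF _ m] by blast
next
  fix x x' y assume "block_lift k m f x = Some y" "block_lift k m f x' = Some y"
  then obtain q q' where q:
    "x \<in> {1..k * m}" "f (blk m x) = Some q" "y = Suc (q * m + (x - 1) mod m)"
    "x' \<in> {1..k * m}" "f (blk m x') = Some q'" "y = Suc (q' * m + (x' - 1) mod m)"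
    unfolding block_lift_Some_iff by blast
  have eq: "q = q'"
    using blk_point[OF m, of q "x - 1"] blk_point[OF m, of q' "x' - 1"] q(3,6) by simp
  then have "blk m x = blk m x'" using inj[OF q(2)] q(5) by simp
  moreover have "(x - 1) mod m = (x' - 1) mod m" using q eq by simp
  moreover have "1 \<le> x" "1 \<le> x'" using q(1,4) by simp_all
  ultimately show "x = x'" using point_blk by metis
next
  fix x y x' assume "block_lift k m f x = Some y" "x' \<in> {1..k * m}" "blk m x' = blk m x"
  then show "\<exists>y'. block_lift k m f x' = Some y'" by (auto simp: block_lift_Some_iff)
next
  fix x x' y y'
  assume "block_lift k m f x = Some y" "block_lift k m f x' = Some y'" "blk m x \<le> blk m x'"
  then show "blk m y \<le> blk m y'"
    using mono by (auto simp: block_lift_Some_iff blk_point[OF m])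
qed

lemma block_lift_mult:
  assumes m: "m > 0" and rng: "\<And>q q'. q < k \<Longrightarrow> f q = Some q' \<Longrightarrow> q' < k"
  shows "block_lift k m f \<otimes>\<^bsub>POI k m\<^esub> block_lift k m g = block_lift k m (g \<circ>\<^sub>m f)"
proof
  fix x
  show "(block_lift k m f \<otimes>\<^bsub>POI k m\<^esub> block_lift k m g) x = block_lift k m (g \<circ>\<^sub>m f) x"
  proof (cases "x \<in> {1..k * m} \<and> f (blk m x) \<noteq> None")
    case False
    then show ?thesis by (auto simp: POI_mult map_comp_def block_lift_def)
  next
    case True
    then obtain q where q: "f (blk m x) = Some q" by auto
    have "Suc (q * m + (x - 1) mod m) \<in> {1..k * m}"
      using True rng[OF blk_less q] point_less[OF _ m] by blast
    moreover have "blk m (Suc (q * m + (x - 1) mod m)) = q" using blk_point[OF m] .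
    ultimately show ?thesis using True q
      by (simp add: POI_mult map_comp_def block_lift_def)
  qed
qed

text \<open>The order isomorphism from the naturals without \<open>i\<close> onto the naturals without \<open>j\<close>.\<close>
definition rook :: "nat \<Rightarrow> nat \<Rightarrow> (nat \<rightharpoonup> nat)" where
  "rook i j q = (if q = i then None
     else Some (let p = (if q < i then q else q - 1) in if p < j then p else Suc p))"

lemma rook_comp: "rook j l \<circ>\<^sub>m rook i j = rook i l"
  by (rule ext) (auto simp: rook_def map_comp_def Let_def)

text \<open>\<open>rook\<close> lives on all naturals; this is why it restricts to the
  \<open>k\<close> block indices.\<close>

lemma rook_less: "i < k \<Longrightarrow> j < k \<Longrightarrow> q < k \<Longrightarrow> rook i j q = Some q' \<Longrightarrow> q' < k"
  by (auto simp: rook_def Let_def split: if_splits)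

lemma rook_same: "rook i i q = (if q = i then None else Some q)"
  by (auto simp: rook_def Let_def)

text \<open>For neighbouring indices a rook is a single step of one block, so a chosen block can be
  moved without disturbing the others.\<close>

lemma rook_adjacent:
  assumes "j = Suc a \<or> a = Suc j"
  shows "rook j a q = (if q = j then None else Some (if q = a then j else q))"
  using assms by (auto simp: rook_def Let_def)

lemma block_lift_rook_in_POI:
  assumes "m > 0" "i < k" "j < k"
  shows "block_lift k m (rook i j) \<in> carrier (POI k m)"
proof (rule block_lift_in_POI[OF assms(1)])
  show "q' < k" if "q < k" "rook i j q = Some q'" for q q'
    using rook_less[OF assms(2,3) that] .
qed (auto simp: rook_def Let_def split: if_splits)

lemma block_lift_rook_mult:
  assumes "m > 0" "i < k" "j < k"
  shows "block_lift k m (rook i j) \<otimes>\<^bsub>POI k m\<^esub> block_lift k m (rook j l) = block_lift k m (rook i l)"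
  using block_lift_mult[OF assms(1), of k "rook i j"] rook_less[OF assms(2,3)] by (simp add: rook_comp)

section \<open>Reduction of every element to units and rooks\<close>

definition displacement :: "nat \<Rightarrow> (nat \<rightharpoonup> nat) \<Rightarrow> nat" where
  "displacement m \<alpha> = (\<Sum>x \<in> dom \<alpha>. nat \<bar>int (blk m (the (\<alpha> x))) - int (blk m x)\<bar>)"

text \<open>As \<open>\<alpha>\<close> is defined on whole blocks and keeps each of them, extending
  it by the identity gives a unit. The missing blocks are then cut off one at a time by
  idempotents.\<close>

lemma block_fixing_decomp:
  assumes m: "m > 0" and \<alpha>: "\<alpha> \<in> carrier (POI k m)"
    and fixing: "\<And>x y. \<alpha> x = Some y \<Longrightarrow> blk m y = blk m x"
    and H: "submonoid H (POI k m)"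
    and units: "\<And>p. block_perm k m p \<Longrightarrow> emb (k * m) p \<in> H"
    and idem: "\<And>i. i < k \<Longrightarrow> block_lift k m (rook i i) \<in> H"
  shows "\<alpha> \<in> H"
proof -
  interpret submonoid H "POI k m" by fact
  define u where "u x = (case \<alpha> x of None \<Rightarrow> x | Some y \<Rightarrow> y)" for x
  have bu: "blk m (u x) = blk m x" for x using fixing by (auto simp: u_def split: option.splits)
  have ur: "u x \<in> {1..k * m}" if "x \<in> {1..k * m}" for x
    using that POI_rng[OF \<alpha>] by (auto simp: u_def split: option.splits)
  have "u permutes {1..k * m}"
  proof (rule inj_imp_permutes)
    show "inj_on u {1..k * m}"
    proof (rule inj_onI)
      fix x x' assume x: "x \<in> {1..k * m}" "x' \<in> {1..k * m}" and eq: "u x = u x'"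
      then have b: "blk m x = blk m x'" using bu by metis
      show "x = x'"
      proof (cases "\<alpha> x")
        case None
        then have "\<alpha> x' = None" using POI_closed[OF \<alpha> _ x(1) b] by fastforce
        then show ?thesis using None eq by (simp add: u_def)
      next
        case (Some y)
        then obtain y' where "\<alpha> x' = Some y'" using POI_closed[OF \<alpha> Some x(2)] b by auto
        then show ?thesis using Some eq POI_inj[OF \<alpha>] by (simp add: u_def)
      qed
    qed
    show "u x = x" if "x \<notin> {1..k * m}" for x
      using that POI_rng(1)[OF \<alpha>] by (cases "\<alpha> x") (auto simp: u_def)
  qed (use ur in auto)
  then have uH: "emb (k * m) u \<in> H" using bu by (intro units) (auto simp: block_perm_def)
  define res where "res B = (\<lambda>x. if blk m x \<in> B then None else emb (k * m) u x)" for B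
  have res: "res B \<in> H" if "finite B" "B \<subseteq> {..<k}" for B
    using that
  proof (induction rule: finite_induct)
    case empty
    show ?case using uH by (simp add: res_def)
  next
    case (insert i B)
    have "res (insert i B) = res B \<otimes>\<^bsub>POI k m\<^esub> block_lift k m (rook i i)"
    proof
      fix x
      show "res (insert i B) x = (res B \<otimes>\<^bsub>POI k m\<^esub> block_lift k m (rook i i)) x"
        using ur[of x] bu[of x] point_blk[of "u x" m]
        by (auto simp: res_def POI_mult map_comp_def emb_def block_lift_def rook_same)
    qed
    then show ?case using insert idem by auto
  qed
  define B where "B = {q. q < k \<and> (\<forall>x y. \<alpha> x = Some y \<longrightarrow> blk m x \<noteq> q)}"
  have "\<alpha> = res B"
  proof
    fix x
    show "\<alpha> x = res B x"
    proof (cases "\<alpha> x")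
      case (Some y)
      then show ?thesis using POI_rng(1)[OF \<alpha> Some] by (auto simp: res_def B_def emb_def u_def)
    next
      case None
      have "blk m x \<in> B" if x: "x \<in> {1..k * m}"
        using blk_less[OF x] POI_closed[OF \<alpha> _ x] None by (fastforce simp: B_def)
      then show ?thesis using None by (auto simp: res_def emb_def)
    qed
  qed
  moreover have "res B \<in> H" by (rule res) (auto simp: B_def)
  ultimately show ?thesis by simp
qed

text \<open>Induction on \<open>displacement\<close>: a rook moves one image block a step towards
  its source, and the opposite rook recovers the element.\<close>

lemma POI_subset_submonoid:
  assumes m: "m > 0" and H: "submonoid H (POI k m)"
    and units: "\<And>p. block_perm k m p \<Longrightarrow> emb (k * m) p \<in> H"
    and rooks: "\<And>i j. i < k \<Longrightarrow> j < k \<Longrightarrow> block_lift k m (rook i j) \<in> H"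
  shows "carrier (POI k m) \<subseteq> H"
proof
  fix \<alpha> assume "\<alpha> \<in> carrier (POI k m)"
  then show "\<alpha> \<in> H"
  proof (induction "displacement m \<alpha>" arbitrary: \<alpha> rule: less_induct)
    case less
    note \<alpha> = less.prems
    interpret submonoid H "POI k m" by fact
    show ?case
    proof (cases "\<forall>x y. \<alpha> x = Some y \<longrightarrow> blk m y = blk m x")
      case True
      then show ?thesis using block_fixing_decomp[OF m \<alpha> _ H units] rooks by blast
    next
      case False
      then obtain x y j where xy: "\<alpha> x = Some y" and j: "j < k" "j = Suc (blk m y) \<or> blk m y = Suc j"
        and closer: "\<bar>int j - int (blk m x)\<bar> < \<bar>int (blk m y) - int (blk m x)\<bar>"
        and free: "\<And>x' y'. \<alpha> x' = Some y' \<Longrightarrow> blk m y' \<noteq> j"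
        using POI_free_neighbour[OF \<alpha>] by metis
      define a where "a = blk m y"
      have a: "a < k" using blk_less[OF POI_rng(2)[OF \<alpha> xy]] by (simp add: a_def)
      have adj: "j = Suc a \<or> a = Suc j" using j(2) by (simp add: a_def)
      define \<beta> where "\<beta> = \<alpha> \<otimes>\<^bsub>POI k m\<^esub> block_lift k m (rook j a)"
      interpret P: monoid "POI k m" by (rule monoid_POI)
      have \<beta>: "\<beta> \<in> carrier (POI k m)"
        unfolding \<beta>_def using \<alpha> block_lift_rook_in_POI[OF m j(1) a] by simp
      have "block_lift k m (rook j a) \<otimes>\<^bsub>POI k m\<^esub> block_lift k m (rook a j) = block_lift k m (rook j j)"
        by (rule block_lift_rook_mult[OF m j(1) a])
      then have "\<beta> \<otimes>\<^bsub>POI k m\<^esub> block_lift k m (rook a j) = \<alpha> \<otimes>\<^bsub>POI k m\<^esub> block_lift k m (rook j j)"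
        unfolding \<beta>_def using \<alpha> block_lift_rook_in_POI[OF m] a j(1) by (simp add: P.m_assoc)
      \<comment> \<open>\<open>rook j j\<close> erases only block \<open>j\<close>, which the image
        of \<open>\<alpha>\<close> misses.\<close>
      also have "\<dots> = \<alpha>"
      proof
        fix z show "(\<alpha> \<otimes>\<^bsub>POI k m\<^esub> block_lift k m (rook j j)) z = \<alpha> z"
        proof (cases "\<alpha> z")
          case (Some w)
          then show ?thesis using free[OF Some] POI_rng[OF \<alpha> Some] point_blk[of w m]
            by (simp add: POI_mult map_comp_def block_lift_def rook_same)
        qed (simp add: POI_mult map_comp_def)
      qed
      finally have \<alpha>_eq: "\<beta> \<otimes>\<^bsub>POI k m\<^esub> block_lift k m (rook a j) = \<alpha>" .
      have \<beta>_val: "\<exists>w'. \<beta> z = Some w' \<and> blk m w' = (if blk m w = a then j else blk m w)"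
        if "\<alpha> z = Some w" for z w
        using that free[OF that] POI_rng[OF \<alpha> that] blk_point[OF m]
        by (auto simp: \<beta>_def POI_mult map_comp_def block_lift_def rook_adjacent[OF adj])
      have "\<beta> z = None" if "\<alpha> z = None" for z
        using that by (simp add: \<beta>_def POI_mult map_comp_def)
      then have dom: "dom \<beta> = dom \<alpha>" using \<beta>_val by (fastforce simp: dom_def)
      have "displacement m \<beta> < displacement m \<alpha>"
        unfolding displacement_def dom
      proof (rule sum_strict_mono_ex1)
        have "dom \<alpha> \<subseteq> {1..k * m}" using POI_rng(1)[OF \<alpha>] by blast
        then show "finite (dom \<alpha>)" by (rule finite_subset) simp
        have le: "nat \<bar>int (blk m (the (\<beta> z))) - int (blk m z)\<bar>
            \<le> nat \<bar>int (blk m (the (\<alpha> z))) - int (blk m z)\<bar>" if "\<alpha> z = Some w" for z w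
        proof -
          \<comment> \<open>Block \<open>a\<close> is hit only from the block of \<open>x\<close>,
            so \<open>closer\<close> covers every point whose image block changes.\<close>
          have "blk m z = blk m x" if "blk m w = a"
            using POI_reflect[OF \<alpha> xy \<open>\<alpha> z = Some w\<close>] POI_reflect[OF \<alpha> \<open>\<alpha> z = Some w\<close> xy] that
            by (auto simp: a_def)
          then show ?thesis using \<beta>_val[OF that] that closer by (auto simp: a_def)
        qed
        then show "\<forall>z \<in> dom \<alpha>. nat \<bar>int (blk m (the (\<beta> z))) - int (blk m z)\<bar>
            \<le> nat \<bar>int (blk m (the (\<alpha> z))) - int (blk m z)\<bar>" by blast
        show "\<exists>z \<in> dom \<alpha>. nat \<bar>int (blk m (the (\<beta> z))) - int (blk m z)\<bar>
            < nat \<bar>int (blk m (the (\<alpha> z))) - int (blk m z)\<bar>"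
          using \<beta>_val[OF xy] xy closer by (intro bexI[of _ x]) (auto simp: a_def)
      qed
      then have "\<beta> \<in> H" using less.hyps \<beta> by blast
      then show ?thesis using \<alpha>_eq rooks[OF a j(1)] m_closed by metis
    qed
  qed
qed

subsection \<open>A generating set with 2k elements\<close>

lemma funpow_closed:
  assumes "\<And>p q. p \<in> P \<Longrightarrow> q \<in> P \<Longrightarrow> p \<circ> q \<in> P" "id \<in> P" "p \<in> P"
  shows "p ^^ n \<in> P"
  using assms by (induction n) auto

lemma funpow_comp_commute:
  assumes "t \<circ> c = c \<circ> t"
  shows "(t \<circ> c) ^^ n = t ^^ n \<circ> c ^^ n"
proof (induction n)
  case (Suc n)
  have "c \<circ> t ^^ n = t ^^ n \<circ> c"
  proof (induction n)
    case (Suc n)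
    then show ?case using assms[symmetric] by (simp add: fun_eq_iff)
  qed simp
  then show ?case using Suc by (simp add: fun_eq_iff)
qed simp

lemma transpose_conj:
  assumes "c \<circ> c' = id" "c' \<circ> c = id"
  shows "c \<circ> transpose x y \<circ> c' = transpose (c x) (c y)"
proof
  fix z
  have "c' z = w \<longleftrightarrow> z = c w" for w using assms by (metis comp_apply id_apply)
  moreover have "c (c' z) = z" using assms(1) by (metis comp_apply id_apply)
  ultimately show "(c \<circ> transpose x y \<circ> c') z = transpose (c x) (c y) z"
    by (auto simp: transpose_def)
qed

text \<open>Conjugating by a transposition needs no inverses, so closure under composition
  suffices.\<close>

lemma transpose_trans:
  assumes comp: "\<And>p q. p \<in> P \<Longrightarrow> q \<in> P \<Longrightarrow> p \<circ> q \<in> P" and id: "id \<in> P"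
    and "transpose x y \<in> P" "transpose y z \<in> P"
  shows "transpose x z \<in> P"
proof (cases "x = z \<or> y = z")
  case False
  then have "transpose x y \<circ> transpose y z \<circ> transpose x y = transpose x z"
    by (intro transpose_comp_triple) auto
  then show ?thesis using comp assms(3,4) by metis
qed (use assms in auto)

section \<open>Symmetric groups from a transposition and a cycle\<close>

text \<open>The cycle \<open>(s, s + 1, ..., s + l - 1)\<close>; arithmetic modulo \<open>l\<close>
  gives its powers in closed form.\<close>

definition seg_rot :: "nat \<Rightarrow> nat \<Rightarrow> nat \<Rightarrow> nat" where
  "seg_rot s l x = (if s \<le> x \<and> x < s + l then s + Suc (x - s) mod l else x)"

lemma seg_rot_funpow:
  "(seg_rot s l ^^ d) x = (if s \<le> x \<and> x < s + l then s + (x - s + d) mod l else x)"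
proof (induction d)
  case (Suc d)
  show ?case
  proof (cases "s \<le> x \<and> x < s + l")
    case True
    then have "(x - s + d) mod l < l" by (intro mod_less_divisor) auto
    then show ?thesis using True Suc by (simp add: seg_rot_def mod_Suc_eq)
  qed (use Suc in \<open>auto simp: seg_rot_def\<close>)
qed auto

lemma seg_rot_order: "seg_rot s l ^^ l = id"
proof
  fix x
  have "(x - s + l) mod l = x - s" if "s \<le> x" "x < s + l"
    using that by (simp del: Nat.add_diff_assoc2)
  then show "(seg_rot s l ^^ l) x = id x" by (auto simp: seg_rot_funpow)
qed

lemma seg_rot_in: "x \<in> {s..<s + l} \<Longrightarrow> seg_rot s l x \<in> {s..<s + l}"
  by (auto simp: seg_rot_def intro!: mod_less_divisor)

lemma seg_rot_permutes: "seg_rot s l permutes {s..<s + l}"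
proof (rule inj_imp_permutes)
  show "inj_on (seg_rot s l) {s..<s + l}"
  proof (cases l)
    case (Suc l')
    \<comment> \<open>The power with exponent \<open>l - 1\<close> serves as inverse.\<close>
    have "seg_rot s l ((seg_rot s l ^^ l') x) = x" for x
      using fun_cong[OF seg_rot_order, of l s x] unfolding Suc by simp
    then have "(seg_rot s l ^^ l') (seg_rot s l x) = x" for x by (simp add: funpow_swap1)
    then show ?thesis by (rule inj_on_inverseI)
  qed simp
qed (use seg_rot_in in \<open>auto simp: seg_rot_def\<close>)

text \<open>Conjugating \<open>transpose e (Suc e)\<close> by powers of the rotation yields further
  transpositions. A rotation that skips \<open>e\<close> gives all of them directly; one that
  includes \<open>e\<close> gives adjacent transpositions, which are then chained.\<close>

lemma transposes_from_rotation:
  assumes comp: "\<And>p q. p \<in> P \<Longrightarrow> q \<in> P \<Longrightarrow> p \<circ> q \<in> P" and id: "id \<in> P"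
    and t: "transpose e (Suc e) \<in> P" and c: "seg_rot s l \<in> P"
    and s: "s = e \<or> s = Suc e" and l: "l > 0" and x: "x \<in> {e..<s + l}"
  shows "transpose e x \<in> P"
proof -
  let ?c = "seg_rot s l"
  have conj: "transpose ((?c ^^ d) e) ((?c ^^ d) (Suc e)) \<in> P" for d
  proof -
    \<comment> \<open>The inverse of \<open>?c ^^ d\<close>, written as a positive power because
      \<open>P\<close> is closed only under composition.\<close>
    let ?c' = "?c ^^ (d * (l - 1))"
    have "?c ^^ (l * d) = (?c ^^ l) ^^ d" by (simp only: funpow_mult)
    then have "?c ^^ (d * l) = id" by (simp add: seg_rot_order mult.commute)
    moreover have "d + d * (l - 1) = d * l" using l by (cases l) auto
    ultimately have "?c ^^ d \<circ> ?c' = id" "?c' \<circ> ?c ^^ d = id"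
      by (metis funpow_add add.commute)+
    then have "transpose ((?c ^^ d) e) ((?c ^^ d) (Suc e)) = ?c ^^ d \<circ> transpose e (Suc e) \<circ> ?c'"
      by (simp add: transpose_conj)
    then show ?thesis using comp t funpow_closed[OF comp id c] by metis
  qed
  from s show ?thesis
  proof
    assume s: "s = Suc e"
    show ?thesis
    proof (cases "x = e")
      case False
      then have "(?c ^^ (x - s)) e = e" "(?c ^^ (x - s)) (Suc e) = x"
        using s x by (auto simp: seg_rot_funpow)
      then show ?thesis using conj by metis
    qed (use id in simp)
  next
    assume s: "s = e"
    have "transpose e (e + d) \<in> P" if "d < l" for d
      using that
    proof (induction d)
      case (Suc d)
      have "(?c ^^ d) e = e + d" "(?c ^^ d) (Suc e) = e + Suc d"
        using s Suc.prems by (auto simp: seg_rot_funpow)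
      then have "transpose (e + d) (e + Suc d) \<in> P" using conj by metis
      then show ?case using Suc transpose_trans[OF comp id] by (metis Suc_lessD)
    qed (use id in simp)
    from this[of "x - e"] show ?thesis using x s by auto
  qed
qed

text \<open>Composing with \<open>transpose a (p a)\<close> makes \<open>a\<close> a fixed point,
  which leaves a permutation of a smaller set. Blocks are still kept, since \<open>a\<close> and
  \<open>p a\<close> share one.\<close>

lemma block_perm_from_transposes:
  assumes comp: "\<And>p q. p \<in> P \<Longrightarrow> q \<in> P \<Longrightarrow> p \<circ> q \<in> P" and id: "id \<in> P"
    and t: "\<And>x y. x \<in> S \<Longrightarrow> y \<in> S \<Longrightarrow> blk m x = blk m y \<Longrightarrow> transpose x y \<in> P"
    and "finite S" "p permutes S" "\<And>x. blk m (p x) = blk m x"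
  shows "p \<in> P"
  using \<open>finite S\<close> t assms(5,6)
proof (induction arbitrary: p rule: finite_induct)
  case (insert a S)
  let ?q = "transpose a (p a) \<circ> p"
  have "?q \<in> P"
  proof (rule insert.IH)
    show "?q permutes S" using permutes_insert_lemma insert.prems(2) .
    show "blk m (?q x) = blk m x" for x
      using insert.prems(3)[of x] insert.prems(3)[of a] by (auto simp: transpose_def)
  qed (use insert.prems in auto)
  moreover have "transpose a (p a) \<in> P"
    using insert.prems permutes_in_image[OF insert.prems(2), of a] by auto
  moreover have "p = transpose a (p a) \<circ> ?q" by (simp add: fun_eq_iff)
  ultimately show ?case using comp by metis
qed (use id in \<open>simp add: permutes_empty\<close>)

text \<open>Together with \<open>transpose (Suc (j * m)) (Suc (Suc (j * m)))\<close> this cycle generates the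
  symmetric group on block \<open>j\<close>; it skips the first point when \<open>m\<close> is even, so its order is
  odd, hence coprime to that of a transposition.\<close>
definition odd_cycle :: "nat \<Rightarrow> nat \<Rightarrow> nat \<Rightarrow> nat" where
  "odd_cycle m j = (if odd m then seg_rot (Suc (j * m)) m else seg_rot (Suc (Suc (j * m))) (m - 1))"

definition unit_gen :: "nat \<Rightarrow> nat \<Rightarrow> nat \<Rightarrow> nat \<Rightarrow> nat" where
  "unit_gen k m i = transpose (Suc (i * m)) (Suc (Suc (i * m))) \<circ> odd_cycle m (Suc i mod k)"

lemma blk_offset: "r < m \<Longrightarrow> blk m (Suc (q * m + r)) = q"
  by (simp add: blk_def)

lemma offset_in_range: "r < m \<Longrightarrow> q < k \<Longrightarrow> Suc (q * m + r) \<in> {1..k * m}"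
  using point_less[of q k m r] by simp

lemma block_perm_first_transpose:
  assumes "m \<ge> 2" "i < k"
  shows "block_perm k m (transpose (Suc (i * m)) (Suc (Suc (i * m))))"
  using assms blk_offset[of 0 m i] blk_offset[of 1 m i]
    offset_in_range[of 0 m i k] offset_in_range[of 1 m i k]
  by (intro block_perm_transpose) auto

lemma seg_rot_blk:
  assumes "\<And>x. x \<in> {s..<s + l} \<Longrightarrow> blk m x = j"
  shows "blk m (seg_rot s l x) = blk m x"
  using assms seg_rot_in[of x s l] by (cases "x \<in> {s..<s + l}") (auto simp: seg_rot_def)

lemma block_perm_odd_cycle:
  assumes "m \<ge> 2" "j < k"
  shows "block_perm k m (odd_cycle m j)"
proof -
  have *: "block_perm k m (seg_rot s l)"
    if "s \<ge> Suc (j * m)" "s + l = Suc (j * m + m)" for s l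
  proof -
    have pt: "x \<in> {1..k * m} \<and> blk m x = j" if "x \<in> {s..<s + l}" for x
    proof -
      have "x - Suc (j * m) < m" "x = Suc (j * m + (x - Suc (j * m)))"
        using that \<open>s \<ge> _\<close> \<open>s + l = _\<close> by auto
      then show ?thesis using blk_offset offset_in_range[OF _ assms(2)] by metis
    qed
    then have "{s..<s + l} \<subseteq> {1..k * m}" by blast
    then have "seg_rot s l permutes {1..k * m}" by (rule permutes_subset[OF seg_rot_permutes])
    then show ?thesis using seg_rot_blk[of s l m j] pt by (auto simp: block_perm_def)
  qed
  show ?thesis unfolding odd_cycle_def using assms(1) by (auto intro!: *)
qed

lemma odd_cycle_fixes:
  assumes x: "x = Suc (i * m) \<or> x = Suc (Suc (i * m))" and m: "m \<ge> 2" and "i \<noteq> j"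
  shows "odd_cycle m j x = x"
proof -
  have "x < Suc (j * m) \<or> Suc (j * m + m) \<le> x"
  proof (cases "i < j")
    case True
    then have "Suc i * m \<le> j * m" by (intro mult_right_mono) auto
    then show ?thesis using x m by auto
  next
    case False
    then have "Suc j * m \<le> i * m" using \<open>i \<noteq> j\<close> by (intro mult_right_mono) auto
    then show ?thesis using x m by auto
  qed
  then show ?thesis using m by (auto simp: odd_cycle_def seg_rot_def)
qed

lemma block_perm_inj: "block_perm k m p \<Longrightarrow> inj p"
  unfolding block_perm_def using permutes_inj by blast

text \<open>With \<open>l\<close> the odd order of the cycle, the power \<open>l\<close> of a
  generator is its transposition and the power \<open>Suc l\<close> is its cycle. For
  \<open>m = 2\<close> the cycle is the identity and \<open>l = 1\<close>.\<close>

lemma unit_gens_generate: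
  assumes k: "k \<ge> 2" and m: "m \<ge> 2"
    and comp: "\<And>p q. p \<in> P \<Longrightarrow> q \<in> P \<Longrightarrow> p \<circ> q \<in> P" and id: "id \<in> P"
    and gens: "\<And>i. i < k \<Longrightarrow> unit_gen k m i \<in> P"
    and p: "block_perm k m p"
  shows "p \<in> P"
proof -
  define l where "l = (if odd m then m else m - 1)"
  have l: "odd l" using m by (auto simp: l_def)
  have ord: "odd_cycle m j ^^ l = id" for j
    by (auto simp: odd_cycle_def l_def seg_rot_order)
  have both: "transpose (Suc (i * m)) (Suc (Suc (i * m))) \<in> P \<and> odd_cycle m (Suc i mod k) \<in> P"
    if i: "i < k" for i
  proof -
    let ?t = "transpose (Suc (i * m)) (Suc (Suc (i * m)))" and ?j = "Suc i mod k"
    let ?c = "odd_cycle m ?j"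
    have ij: "i \<noteq> ?j" using i k by (cases "Suc i = k") auto
    have "?j < k" using k by simp
    then have injc: "inj ?c" using block_perm_inj block_perm_odd_cycle[OF m] by blast
    have fixed: "?c (Suc (i * m)) = Suc (i * m)" "?c (Suc (Suc (i * m))) = Suc (Suc (i * m))"
      using odd_cycle_fixes[OF _ m ij] by auto
    \<comment> \<open>An injective map that fixes both swapped points commutes with the
      swap.\<close>
    have comm: "?t \<circ> ?c = ?c \<circ> ?t"
    proof
      fix x
      show "(?t \<circ> ?c) x = (?c \<circ> ?t) x"
        using fixed injD[OF injc, of x "Suc (i * m)"] injD[OF injc, of x "Suc (Suc (i * m))"]
        by (auto simp: transpose_def)
    qed
    have t2: "?t ^^ (2 * e) = id" for e
      by (induction e) (auto simp: fun_eq_iff)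
    obtain e where e: "l = Suc (2 * e)" using l by (auto elim: oddE)
    have "unit_gen k m i ^^ l = ?t ^^ l \<circ> ?c ^^ l"
      unfolding unit_gen_def by (rule funpow_comp_commute[OF comm])
    also have "\<dots> = ?t" using t2[of e] ord by (simp add: e)
    finally have "?t \<in> P" using funpow_closed[OF comp id gens[OF i]] by metis
    have "unit_gen k m i ^^ Suc l = ?t ^^ Suc l \<circ> ?c ^^ Suc l"
      unfolding unit_gen_def by (rule funpow_comp_commute[OF comm])
    also have "\<dots> = ?c" using t2[of "Suc e"] ord by (simp add: e)
    finally have "?c \<in> P" using funpow_closed[OF comp id gens[OF i]] by metis
    with \<open>?t \<in> P\<close> show ?thesis by blast
  qed
  have cyc: "odd_cycle m j \<in> P" if "j < k" for j
  proof (cases j)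
    \<comment> \<open>The cycle of block 0 sits in the last generator, by the wrap-around modulo
      \<open>k\<close>.\<close>
    case 0
    then show ?thesis using both[of "k - 1"] k by simp
  next
    case (Suc i)
    then show ?thesis using both[of i] that by simp
  qed
  \<comment> \<open>Transpositions with the first point of each block;
    \<open>transpose_trans\<close> joins two of them into any transposition within the
    block.\<close>
  have star: "transpose (Suc (blk m x * m)) x \<in> P" if x: "x \<in> {1..k * m}" for x
  proof -
    let ?j = "blk m x"
    let ?s = "if odd m then Suc (?j * m) else Suc (Suc (?j * m))"
    have j: "?j < k" using blk_less[OF x] .
    have xr: "x = Suc (?j * m + (x - 1) mod m)" using point_blk[of x m] x by simp
    have "(x - 1) mod m < m" using m by simp
    then have "Suc (?j * m + (x - 1) mod m) < Suc (?j * m + m)"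
      "Suc (?j * m) \<le> Suc (?j * m + (x - 1) mod m)" by simp_all
    then have "x < Suc (?j * m + m)" "Suc (?j * m) \<le> x" unfolding xr[symmetric] .
    moreover have "?s + l = Suc (?j * m + m)" using m by (simp add: l_def)
    ultimately have "x \<in> {Suc (?j * m)..<?s + l}" by simp
    moreover have "seg_rot ?s l \<in> P" using cyc[OF j] by (auto simp: odd_cycle_def l_def split: if_splits)
    moreover have "?s = Suc (?j * m) \<or> ?s = Suc (Suc (?j * m))" by simp
    ultimately show ?thesis
      using transposes_from_rotation[OF comp id, of "Suc (?j * m)" ?s l x] both[OF j] odd_pos[OF l]
      by blast
  qed
  show ?thesis
  proof (rule block_perm_from_transposes[OF comp id])
    show "transpose x y \<in> P" if "x \<in> {1..k * m}" "y \<in> {1..k * m}" "blk m x = blk m y" for x y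
      using star[OF that(1)] star[OF that(2)] that(3) transpose_trans[OF comp id]
      by (metis transpose_commute)
  qed (use p in \<open>auto simp: block_perm_def\<close>)
qed

section \<open>Rooks from a cycle of rooks, and the full generating set\<close>

lemma rook_gens_generate:
  assumes m: "m > 0" and H: "submonoid H (POI k m)"
    and gens: "\<And>i. i < k \<Longrightarrow> block_lift k m (rook i (Suc i mod k)) \<in> H"
    and i: "i < k" and j: "j < k"
  shows "block_lift k m (rook i j) \<in> H"
proof -
  interpret submonoid H "POI k m" by fact
  have "block_lift k m (rook i ((i + Suc d) mod k)) \<in> H" for d
  proof (induction d)
    case 0
    then show ?case using gens[OF i] by simp
  next
    case (Suc d)
    let ?q = "(i + Suc d) mod k"
    have q: "?q < k" using i by simp
    have "block_lift k m (rook i ?q) \<otimes>\<^bsub>POI k m\<^esub> block_lift k m (rook ?q (Suc ?q mod k)) \<in> H"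
      using Suc gens[OF q] by (rule m_closed)
    then have "block_lift k m (rook i (Suc ?q mod k)) \<in> H" by (simp only: block_lift_rook_mult[OF m i q])
    then show ?case by (simp add: mod_Suc_eq)
  qed
  \<comment> \<open>Walking on past \<open>k\<close> reaches every \<open>j\<close>, also those with
    \<open>j \<le> i\<close>.\<close>
  moreover have "i + Suc (k + j - i - 1) = k + j" using i by simp
  ultimately show ?thesis using j by (metis mod_add_self1 mod_less)
qed

definition POI_gens :: "nat \<Rightarrow> nat \<Rightarrow> (nat \<rightharpoonup> nat) set" where
  "POI_gens k m = (\<lambda>i. emb (k * m) (unit_gen k m i)) ` {..<k} \<union>
     (\<lambda>i. block_lift k m (rook i (Suc i mod k))) ` {..<k}"

text \<open>An upper bound is enough here; that the generators are distinct follows from the lower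
  bound on generating sets.\<close>

lemma card_POI_gens: "card (POI_gens k m) \<le> 2 * k"
  unfolding POI_gens_def
  using card_image_le[of "{..<k}" "\<lambda>i. emb (k * m) (unit_gen k m i)"]
    card_image_le[of "{..<k}" "\<lambda>i. block_lift k m (rook i (Suc i mod k))"]
  by (intro order.trans[OF card_Un_le]) simp

lemma generates_POI_gens:
  assumes k: "k \<ge> 2" and m: "m \<ge> 2"
  shows "generates_monoid (POI k m) (POI_gens k m)"
proof -
  have m0: "m > 0" using m by simp
  have ug: "block_perm k m (unit_gen k m i)" if "i < k" for i
    unfolding unit_gen_def using that k
    by (intro block_perm_comp block_perm_first_transpose block_perm_odd_cycle m) auto
  have sub: "POI_gens k m \<subseteq> carrier (POI k m)"
    unfolding POI_gens_def using ug emb_in_POI[OF m0] block_lift_rook_in_POI[OF m0] by auto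
  have "carrier (POI k m) \<subseteq> H" if H: "submonoid H (POI k m)" and A: "POI_gens k m \<subseteq> H" for H
  proof (rule POI_subset_submonoid[OF m0 H])
    interpret submonoid H "POI k m" by fact
    show "block_lift k m (rook i j) \<in> H" if "i < k" "j < k" for i j
      by (rule rook_gens_generate[OF m0 H _ that]) (use A in \<open>auto simp: POI_gens_def\<close>)
    show "emb (k * m) p \<in> H" if "block_perm k m p" for p
    proof -
      \<comment> \<open>The set carries \<open>block_perm\<close> along with membership in
        \<open>H\<close> because \<open>emb_mult\<close> needs a permutation.\<close>
      have "p \<in> {p. block_perm k m p \<and> emb (k * m) p \<in> H}"
      proof (rule unit_gens_generate[OF k m _ _ _ that])
        fix p q
        assume "p \<in> {p. block_perm k m p \<and> emb (k * m) p \<in> H}"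
          "q \<in> {p. block_perm k m p \<and> emb (k * m) p \<in> H}"
        then have pq: "block_perm k m p" "emb (k * m) p \<in> H" "block_perm k m q" "emb (k * m) q \<in> H"
          by simp_all
        have "emb (k * m) q \<otimes>\<^bsub>POI k m\<^esub> emb (k * m) p = emb (k * m) (p \<circ> q)"
          by (rule emb_mult) (use pq in \<open>simp add: block_perm_def\<close>)
        then have "emb (k * m) (p \<circ> q) \<in> H" using m_closed[OF pq(4,2)] by simp
        with block_perm_comp[OF pq(3,1)] show "p \<circ> q \<in> {p. block_perm k m p \<and> emb (k * m) p \<in> H}"
          by simp
      next
        show "id \<in> {p. block_perm k m p \<and> emb (k * m) p \<in> H}"
          using one_closed by (simp add: one_POI block_perm_id)
      qed (use ug A in \<open>auto simp: POI_gens_def\<close>)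
      then show ?thesis by simp
    qed
  qed
  moreover have "submonoid (carrier (POI k m)) (POI k m)"
    by (rule submonoid.intro) (simp_all add: monoid.m_closed[OF monoid_POI] monoid.one_closed[OF monoid_POI])
  ultimately show ?thesis using sub unfolding generates_monoid_def monoid_span_def by blast
qed

subsection \<open>Lower bound\<close>

text \<open>The form used for lower bounds: a generating set cannot lie inside a proper
  submonoid.\<close>

lemma generates_monoid_subset:
  assumes "generates_monoid M A" "submonoid H M" "A \<subseteq> H"
  shows "carrier M \<subseteq> H"
  using assms unfolding generates_monoid_def monoid_span_def by blast

lemma dom_POI_subset: "\<alpha> \<in> carrier (POI k m) \<Longrightarrow> dom \<alpha> \<subseteq> {1..k * m}"
  using POI_rng(1) by blast

text \<open>Moving a block would leave some block outside the image, but a total injection of a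
  finite set into itself is onto.\<close>

lemma POI_total_blk:
  assumes m: "m > 0" and \<alpha>: "\<alpha> \<in> carrier (POI k m)" and full: "dom \<alpha> = {1..k * m}"
    and xy: "\<alpha> x = Some y"
  shows "blk m y = blk m x"
proof (rule ccontr)
  assume "blk m y \<noteq> blk m x"
  then obtain j where j: "j < k" and free: "\<And>x' y'. \<alpha> x' = Some y' \<Longrightarrow> blk m y' \<noteq> j"
    using POI_free_neighbour[OF \<alpha> xy] by metis
  have ex: "\<exists>y. \<alpha> x = Some y" if "x \<in> {1..k * m}" for x using that full by blast
  have "inj_on (\<lambda>x. the (\<alpha> x)) {1..k * m}"
    by (rule inj_onI) (metis ex POI_inj[OF \<alpha>] option.sel)
  moreover have "(\<lambda>x. the (\<alpha> x)) ` {1..k * m} \<subseteq> {1..k * m}"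
  proof (rule image_subsetI)
    fix x assume "x \<in> {1..k * m}"
    then obtain y where "\<alpha> x = Some y" using ex by blast
    then show "the (\<alpha> x) \<in> {1..k * m}" using POI_rng(2)[OF \<alpha>] by simp
  qed
  ultimately have "(\<lambda>x. the (\<alpha> x)) ` {1..k * m} = {1..k * m}"
    by (intro endo_inj_surj) auto
  moreover have "Suc (j * m + 0) \<in> {1..k * m}" using m j by (intro offset_in_range)
  ultimately obtain x' where "x' \<in> {1..k * m}" "the (\<alpha> x') = Suc (j * m + 0)"
    by (metis (no_types, lifting) imageE)
  then show False using free ex blk_offset[of 0 m j] m by (metis option.sel)
qed

text \<open>A total \<open>\<alpha>\<close> keeps every block, and the domain of
  \<open>\<beta>\<close> is a union of blocks.\<close>

lemma dom_mult_total:
  assumes m: "m > 0" and \<alpha>: "\<alpha> \<in> carrier (POI k m)" and \<beta>: "\<beta> \<in> carrier (POI k m)"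
    and full: "dom \<alpha> = {1..k * m}"
  shows "dom (\<alpha> \<otimes>\<^bsub>POI k m\<^esub> \<beta>) = dom \<beta>"
proof -
  have "x \<in> dom (\<alpha> \<otimes>\<^bsub>POI k m\<^esub> \<beta>) \<longleftrightarrow> x \<in> dom \<beta>" if x: "x \<in> {1..k * m}" for x
  proof -
    obtain y where y: "\<alpha> x = Some y" using x full by blast
    have "blk m y = blk m x" using POI_total_blk[OF m \<alpha> full y] .
    then have "\<beta> y \<noteq> None \<longleftrightarrow> \<beta> x \<noteq> None"
      using POI_closed[OF \<beta>] x POI_rng(2)[OF \<alpha> y] by (metis not_None_eq)
    then show ?thesis using y by (auto simp: POI_mult map_comp_def)
  qed
  moreover have "dom (\<alpha> \<otimes>\<^bsub>POI k m\<^esub> \<beta>) \<subseteq> {1..k * m}"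
    using full by (auto simp: POI_mult map_comp_def split: option.splits)
  ultimately show ?thesis using dom_POI_subset[OF \<beta>] by blast
qed

lemma dom_mult_subset: "dom (\<alpha> \<otimes>\<^bsub>POI k m\<^esub> \<beta>) \<subseteq> dom \<alpha>"
  by (auto simp: POI_mult map_comp_def split: option.splits)

lemma mult_total_iff:
  assumes "m > 0" "\<alpha> \<in> carrier (POI k m)" "\<beta> \<in> carrier (POI k m)"
  shows "dom (\<alpha> \<otimes>\<^bsub>POI k m\<^esub> \<beta>) = {1..k * m} \<longleftrightarrow> dom \<alpha> = {1..k * m} \<and> dom \<beta> = {1..k * m}"
  using dom_mult_subset[where k = k and m = m and \<alpha> = \<alpha> and \<beta> = \<beta>]
    dom_POI_subset[OF assms(2)] dom_mult_total[OF assms]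
  by (metis subset_antisym)

section \<open>Counting the generators that are not units\<close>

definition without_block :: "nat \<Rightarrow> nat \<Rightarrow> nat \<Rightarrow> nat set" where
  "without_block k m i = {x \<in> {1..k * m}. blk m x \<noteq> i}"

lemma first_notin_without_block: "m > 0 \<Longrightarrow> Suc (i * m) \<notin> without_block k m i"
  using blk_offset[of 0 m i] by (simp add: without_block_def)

lemma first_in_range: "m > 0 \<Longrightarrow> i < k \<Longrightarrow> Suc (i * m) \<in> {1..k * m}"
  using offset_in_range[of 0 m i k] by simp

lemma without_block_inj: "m > 0 \<Longrightarrow> inj_on (without_block k m) {..<k}"
proof (rule inj_onI)
  fix i j assume "m > 0" "i \<in> {..<k}" "without_block k m i = without_block k m j"
  then have "Suc (i * m) \<notin> without_block k m j" "Suc (i * m) \<in> {1..k * m}"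
    using first_notin_without_block first_in_range by (metis, blast)
  then show "i = j" using blk_offset[of 0 m i] \<open>m > 0\<close> by (simp add: without_block_def)
qed

text \<open>The elements whose domain is not the complement of block \<open>i\<close> form a proper submonoid.\<close>
lemma generator_missing_block:
  assumes m: "m > 0" and i: "i < k" and gen: "generates_monoid (POI k m) A"
  shows "\<exists>a \<in> A. dom a = without_block k m i"
proof (rule ccontr)
  let ?M = "POI k m" and ?D = "without_block k m i"
  interpret monoid ?M by (rule monoid_POI)
  assume none: "\<not> ?thesis"
  let ?T = "{\<gamma> \<in> carrier ?M. dom \<gamma> \<noteq> ?D}"
  have ne: "?D \<noteq> {1..k * m}"
    using first_notin_without_block[OF m, of i k] first_in_range[OF m i] by metis
  have "submonoid ?T ?M"
  proof
    have "dom \<one>\<^bsub>?M\<^esub> = {1..k * m}" by (auto simp: one_POI emb_def dom_def)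
    then show "\<one>\<^bsub>?M\<^esub> \<in> ?T" using ne by simp
  next
    fix \<alpha> \<beta> assume "\<alpha> \<in> ?T" "\<beta> \<in> ?T"
    then have \<alpha>: "\<alpha> \<in> carrier ?M" "dom \<alpha> \<noteq> ?D" and \<beta>: "\<beta> \<in> carrier ?M" "dom \<beta> \<noteq> ?D" by auto
    have "dom (\<alpha> \<otimes>\<^bsub>?M\<^esub> \<beta>) \<noteq> ?D"
    proof
      assume eq: "dom (\<alpha> \<otimes>\<^bsub>?M\<^esub> \<beta>) = ?D"
      then have sub: "?D \<subseteq> dom \<alpha>" using dom_mult_subset by metis
      \<comment> \<open>The domain of \<open>\<alpha>\<close> strictly contains \<open>?D\<close>
        and is a union of blocks, so it contains block \<open>i\<close> as well and is
        everything.\<close>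
      then obtain x where x: "x \<in> dom \<alpha>" "x \<notin> ?D" using \<alpha>(2) by blast
      then obtain y where xy: "\<alpha> x = Some y" by blast
      have "blk m x = i" using x(2) POI_rng(1)[OF \<alpha>(1) xy] by (simp add: without_block_def)
      then have "x' \<in> dom \<alpha>" if "x' \<in> {1..k * m}" "x' \<notin> ?D" for x'
        using POI_closed[OF \<alpha>(1) xy that(1)] that by (auto simp: without_block_def)
      then have "dom \<alpha> = {1..k * m}" using sub dom_POI_subset[OF \<alpha>(1)] by blast
      then show False using dom_mult_total[OF m \<alpha>(1) \<beta>(1)] eq \<beta>(2) by simp
    qed
    then show "\<alpha> \<otimes>\<^bsub>?M\<^esub> \<beta> \<in> ?T" using \<alpha> \<beta> by simp
  qed auto
  moreover have "A \<subseteq> ?T" using none gen by (auto simp: generates_monoid_def)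
  ultimately have "carrier ?M \<subseteq> ?T" by (rule generates_monoid_subset[OF gen])
  moreover have "block_lift k m (rook i i) \<in> carrier ?M" using block_lift_rook_in_POI[OF m i i] .
  moreover have "dom (block_lift k m (rook i i)) = ?D"
    by (auto simp: block_lift_def rook_same without_block_def dom_def split: if_splits)
  ultimately show False by auto
qed

lemma card_partial_generators:
  assumes m: "m > 0" and "finite A" and gen: "generates_monoid (POI k m) A"
  shows "k \<le> card {a \<in> A. dom a \<noteq> {1..k * m}}"
proof -
  have "without_block k m ` {..<k} \<subseteq> dom ` {a \<in> A. dom a \<noteq> {1..k * m}}"
  proof (rule image_subsetI)
    fix i assume "i \<in> {..<k}"
    then obtain a where "a \<in> A" "dom a = without_block k m i"
      using generator_missing_block[OF m _ gen] by blast
    moreover have "without_block k m i \<noteq> {1..k * m}"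
      using first_notin_without_block[OF m, of i k] first_in_range[OF m, of i k] \<open>i \<in> _\<close>
      by (metis lessThan_iff)
    ultimately show "without_block k m i \<in> dom ` {a \<in> A. dom a \<noteq> {1..k * m}}"
      by (metis (mono_tags, lifting) image_eqI mem_Collect_eq)
  qed
  then have "card (without_block k m ` {..<k}) \<le> card {a \<in> A. dom a \<noteq> {1..k * m}}"
    using assms(2) by (intro surj_card_le) auto
  then show ?thesis by (simp add: card_image[OF without_block_inj[OF m]])
qed

section \<open>Counting the units among the generators by signs\<close>

text \<open>The component of a unit in the \<open>i\<close>-th factor of
  \<open>(S\<^sub>m)\<^sup>k\<close>, extended by the identity to all naturals so that
  \<open>evenperm\<close> applies.\<close>

definition on_block :: "nat \<Rightarrow> (nat \<rightharpoonup> nat) \<Rightarrow> nat \<Rightarrow> nat \<Rightarrow> nat" where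
  "on_block m \<alpha> i x = (if blk m x = i then (case \<alpha> x of None \<Rightarrow> x | Some y \<Rightarrow> y) else x)"

lemma on_block_permutes:
  assumes m: "m > 0" and \<alpha>: "\<alpha> \<in> carrier (POI k m)" and full: "dom \<alpha> = {1..k * m}"
  shows "on_block m \<alpha> i permutes {1..k * m}"
proof (rule inj_imp_permutes)
  have ex: "\<exists>y. \<alpha> x = Some y \<and> y \<in> {1..k * m} \<and> blk m y = blk m x" if "x \<in> {1..k * m}" for x
    using that full POI_rng(2)[OF \<alpha>] POI_total_blk[OF m \<alpha> full] by blast
  show "inj_on (on_block m \<alpha> i) {1..k * m}"
  proof (rule inj_onI)
    fix x x' assume "x \<in> {1..k * m}" "x' \<in> {1..k * m}" "on_block m \<alpha> i x = on_block m \<alpha> i x'"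
    then show "x = x'" using ex[of x] ex[of x'] POI_inj[OF \<alpha>]
      by (auto simp: on_block_def split: if_splits)
  qed
  show "on_block m \<alpha> i x \<in> {1..k * m}" if "x \<in> {1..k * m}" for x
    using ex[OF that] that by (auto simp: on_block_def)
  show "on_block m \<alpha> i x = x" if "x \<notin> {1..k * m}" for x
  proof -
    have "\<alpha> x = None" using that full by blast
    then show ?thesis by (simp add: on_block_def)
  qed
qed auto

lemma on_block_mult:
  assumes m: "m > 0" and \<alpha>: "\<alpha> \<in> carrier (POI k m)" "dom \<alpha> = {1..k * m}"
    and \<beta>: "\<beta> \<in> carrier (POI k m)" "dom \<beta> = {1..k * m}"
  shows "on_block m (\<alpha> \<otimes>\<^bsub>POI k m\<^esub> \<beta>) i = on_block m \<beta> i \<circ> on_block m \<alpha> i"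
proof
  fix x
  show "on_block m (\<alpha> \<otimes>\<^bsub>POI k m\<^esub> \<beta>) i x = (on_block m \<beta> i \<circ> on_block m \<alpha> i) x"
  proof (cases "\<alpha> x")
    case None
    then have "\<beta> x = None" using \<alpha>(2) \<beta>(2) by (metis domIff)
    then show ?thesis using None by (simp add: on_block_def POI_mult map_comp_def)
  next
    case (Some y)
    have "blk m y = blk m x" using POI_total_blk[OF m \<alpha> Some] .
    moreover obtain z where "\<beta> y = Some z" using POI_rng(2)[OF \<alpha>(1) Some] \<beta>(2) by blast
    ultimately show ?thesis using Some by (simp add: on_block_def POI_mult map_comp_def)
  qed
qed

text \<open>The sign vector of a unit in \<open>(\<int>/2)\<^sup>k\<close>, encoded as a subset of
  the block indices.\<close>

definition odd_blocks :: "nat \<Rightarrow> nat \<Rightarrow> (nat \<rightharpoonup> nat) \<Rightarrow> nat set" where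
  "odd_blocks k m \<alpha> = {i \<in> {..<k}. \<not> evenperm (on_block m \<alpha> i)}"

text \<open>The sign is multiplicative on each block, so sign vectors add modulo 2.\<close>

lemma odd_blocks_mult:
  assumes "m > 0" "\<alpha> \<in> carrier (POI k m)" "dom \<alpha> = {1..k * m}"
    "\<beta> \<in> carrier (POI k m)" "dom \<beta> = {1..k * m}"
  shows "i \<in> odd_blocks k m (\<alpha> \<otimes>\<^bsub>POI k m\<^esub> \<beta>) \<longleftrightarrow>
    i < k \<and> (i \<in> odd_blocks k m \<alpha>) \<noteq> (i \<in> odd_blocks k m \<beta>)"
proof -
  have "permutation (on_block m \<alpha> i)" "permutation (on_block m \<beta> i)"
    using on_block_permutes assms permutes_imp_permutation[of "{1..k * m}"] by blast+
  then show ?thesis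
    using on_block_mult[OF assms] by (auto simp: odd_blocks_def evenperm_comp)
qed

lemma odd_card_sym_diff:
  assumes "finite X" "finite Y"
  shows "odd (card ((X - Y) \<union> (Y - X))) \<longleftrightarrow> odd (card X) \<noteq> odd (card Y)"
proof -
  have "card ((X - Y) \<union> (Y - X)) = card (X - Y) + card (Y - X)"
    using assms by (intro card_Un_disjoint) auto
  moreover have "card X = card (X - Y) + card (X \<inter> Y)" "card Y = card (Y - X) + card (X \<inter> Y)"
    using assms card_Diff_subset_Int[of X Y] card_Diff_subset_Int[of Y X]
      card_mono[of X "X \<inter> Y"] card_mono[of Y "X \<inter> Y"] by (auto simp: Int_commute)
  ultimately show ?thesis by presburger
qed

text \<open>The witness swaps the first two points of each block in \<open>Q\<close> and fixes
  everything else.\<close>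

lemma all_odd_blocks:
  assumes m: "m \<ge> 2" and Q: "Q \<subseteq> {..<k}"
  shows "\<exists>\<gamma> \<in> carrier (POI k m). dom \<gamma> = {1..k * m} \<and> odd_blocks k m \<gamma> = Q"
proof -
  define t where "t j = transpose (Suc (j * m)) (Suc (Suc (j * m)))" for j
  have t: "t j permutes {1..k * m}" "\<And>x. blk m (t j x) = blk m x" if "j < k" for j
    using block_perm_first_transpose[OF m that] by (auto simp: block_perm_def t_def)
  define q where "q x = (if blk m x \<in> Q then t (blk m x) x else x)" for x
  have bq: "blk m (q x) = blk m x" for x using t(2) Q by (auto simp: q_def)
  have "q permutes {1..k * m}"
  proof (rule inj_imp_permutes)
    have "q (q x) = x" for x
      using bq[of x] by (cases "blk m x \<in> Q") (simp_all add: q_def t_def)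
    then show "inj_on q {1..k * m}" by (rule inj_on_inverseI)
    show "q x \<in> {1..k * m}" if "x \<in> {1..k * m}" for x
      using that permutes_in_image[OF t(1)[OF blk_less[OF that]], of x] by (simp add: q_def)
    show "q x = x" if "x \<notin> {1..k * m}" for x
      using permutes_not_in[OF t(1) that] Q by (auto simp: q_def)
  qed simp
  then have bp: "block_perm k m q" using bq by (simp add: block_perm_def)
  let ?\<gamma> = "emb (k * m) q"
  have "on_block m ?\<gamma> i = (if i \<in> Q then t i else id)" if "i < k" for i
  proof
    fix x
    show "on_block m ?\<gamma> i x = (if i \<in> Q then t i else id) x"
    proof (cases "x \<in> {1..k * m}")
      case True
      have "t i x = x" if "blk m x \<noteq> i"
        using that blk_offset[of 0 m i] blk_offset[of 1 m i] m by (auto simp: t_def transpose_def)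
      then show ?thesis using True by (auto simp: on_block_def emb_def q_def)
    next
      case False
      then show ?thesis using permutes_not_in[OF t(1)[OF that] False]
        by (auto simp: on_block_def emb_def)
    qed
  qed
  then have "odd_blocks k m ?\<gamma> = Q"
    using Q by (auto simp: odd_blocks_def t_def evenperm_swap split: if_splits)
  moreover have "dom ?\<gamma> = {1..k * m}" by (auto simp: emb_def dom_def)
  ultimately show ?thesis using emb_in_POI[OF _ bp] m by auto
qed

text \<open>The sign vectors of the units fill \<open>(\<int>/2)\<^sup>k\<close>, and products of units from \<open>U\<close> realise at
  most \<open>2 ^ card U\<close> of them.\<close>
lemma card_total_generators:
  assumes m: "m \<ge> 2" and fin: "finite A" and gen: "generates_monoid (POI k m) A"
  shows "k \<le> card {a \<in> A. dom a = {1..k * m}}"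
proof -
  let ?M = "POI k m"
  interpret monoid ?M by (rule monoid_POI)
  have m0: "m > 0" using m by simp
  define U where "U = {a \<in> A. dom a = {1..k * m}}"
  have finU: "finite U" using fin by (simp add: U_def)
  \<comment> \<open>\<open>\<Phi> B\<close> is the sum modulo 2 of the sign vectors of the elements
    of \<open>B\<close>.\<close>
  define \<Phi> where "\<Phi> B = {i \<in> {..<k}. odd (card {a \<in> B. i \<in> odd_blocks k m a})}" for B
  \<comment> \<open>Only total elements are constrained; this survives products because a total
    product has total factors.\<close>
  let ?S = "{\<gamma> \<in> carrier ?M. dom \<gamma> = {1..k * m} \<longrightarrow> odd_blocks k m \<gamma> \<in> \<Phi> ` Pow U}"
  have "submonoid ?S ?M"
  proof
    have "on_block m \<one>\<^bsub>?M\<^esub> i = id" for i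
      by (auto simp: on_block_def one_POI emb_def fun_eq_iff)
    then have "odd_blocks k m \<one>\<^bsub>?M\<^esub> = \<Phi> {}" by (simp add: odd_blocks_def \<Phi>_def)
    then show "\<one>\<^bsub>?M\<^esub> \<in> ?S" by simp
  next
    fix \<alpha> \<beta> assume "\<alpha> \<in> ?S" "\<beta> \<in> ?S"
    then have \<alpha>: "\<alpha> \<in> carrier ?M" and \<beta>: "\<beta> \<in> carrier ?M" by auto
    have "odd_blocks k m (\<alpha> \<otimes>\<^bsub>?M\<^esub> \<beta>) \<in> \<Phi> ` Pow U" if "dom (\<alpha> \<otimes>\<^bsub>?M\<^esub> \<beta>) = {1..k * m}"
    proof -
      have full: "dom \<alpha> = {1..k * m}" "dom \<beta> = {1..k * m}"
        using that mult_total_iff[OF m0 \<alpha> \<beta>] by auto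
      obtain B where B: "B \<subseteq> U" "odd_blocks k m \<alpha> = \<Phi> B" using \<open>\<alpha> \<in> ?S\<close> full by auto
      obtain C where C: "C \<subseteq> U" "odd_blocks k m \<beta> = \<Phi> C" using \<open>\<beta> \<in> ?S\<close> full by auto
      \<comment> \<open>Contributions of elements common to \<open>B\<close> and \<open>C\<close>
        cancel modulo 2.\<close>
      let ?D = "(B - C) \<union> (C - B)"
      have "i \<in> odd_blocks k m (\<alpha> \<otimes>\<^bsub>?M\<^esub> \<beta>) \<longleftrightarrow> i \<in> \<Phi> ?D" for i
      proof -
        let ?r = "\<lambda>X. {a \<in> X. i \<in> odd_blocks k m a}"
        have "?r ?D = (?r B - ?r C) \<union> (?r C - ?r B)" by auto
        moreover have "finite (?r B)" "finite (?r C)"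
          using finite_subset[OF B(1) finU] finite_subset[OF C(1) finU] by simp_all
        ultimately have "odd (card (?r ?D)) \<longleftrightarrow> odd (card (?r B)) \<noteq> odd (card (?r C))"
          by (simp only: odd_card_sym_diff)
        then show ?thesis
          using odd_blocks_mult[OF m0 \<alpha> full(1) \<beta> full(2), of i] B(2) C(2) by (auto simp: \<Phi>_def)
      qed
      then have "odd_blocks k m (\<alpha> \<otimes>\<^bsub>?M\<^esub> \<beta>) = \<Phi> ?D" by blast
      moreover have "?D \<in> Pow U" using B(1) C(1) by blast
      ultimately show ?thesis by blast
    qed
    then show "\<alpha> \<otimes>\<^bsub>?M\<^esub> \<beta> \<in> ?S" using \<alpha> \<beta> by simp
  qed auto
  moreover have "A \<subseteq> ?S"
  proof
    fix a assume a: "a \<in> A"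
    have "odd_blocks k m a \<in> \<Phi> ` Pow U" if "dom a = {1..k * m}"
    proof
      have "{b \<in> {a}. i \<in> odd_blocks k m b} = (if i \<in> odd_blocks k m a then {a} else {})" for i
        by auto
      then show "odd_blocks k m a = \<Phi> {a}" by (auto simp: \<Phi>_def odd_blocks_def)
      show "{a} \<in> Pow U" using a that by (simp add: U_def)
    qed
    then show "a \<in> ?S" using a gen by (auto simp: generates_monoid_def)
  qed
  ultimately have sub: "carrier ?M \<subseteq> ?S" by (rule generates_monoid_subset[OF gen])
  have "Pow {..<k} \<subseteq> \<Phi> ` Pow U"
  proof
    fix Q assume "Q \<in> Pow {..<k}"
    then obtain \<gamma> where "\<gamma> \<in> carrier ?M" "dom \<gamma> = {1..k * m}" "odd_blocks k m \<gamma> = Q"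
      using all_odd_blocks[OF m] by (metis PowD)
    then show "Q \<in> \<Phi> ` Pow U" using sub by blast
  qed
  then have "card (Pow {..<k}) \<le> card (Pow U)" using finU by (intro surj_card_le) auto
  then have "(2::nat) ^ k \<le> 2 ^ card U" using finU by (simp add: card_Pow)
  then show ?thesis by (simp add: U_def)
qed

theorem proposition2p4:
  fixes k m :: nat
  assumes "k \<ge> 2" and "m \<ge> 2"
  shows "monoid_rank (POI k m) = 2 * k"
proof -
  have lower: "2 * k \<le> card A" if A: "finite A" "generates_monoid (POI k m) A" for A
  proof -
    have "card A = card ({a \<in> A. dom a = {1..k * m}} \<union> {a \<in> A. dom a \<noteq> {1..k * m}})"
      by (rule arg_cong[of _ _ card]) auto
    also have "\<dots> = card {a \<in> A. dom a = {1..k * m}} + card {a \<in> A. dom a \<noteq> {1..k * m}}"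
      using A(1) by (intro card_Un_disjoint) auto
    finally show ?thesis
      using card_total_generators[OF assms(2) A] card_partial_generators[OF _ A] assms(2) by simp
  qed
  have fin: "finite (POI_gens k m)" by (simp add: POI_gens_def)
  \<comment> \<open>The lower bound, applied to the generating set itself, turns its upper estimate
    into an equality.\<close>
  have "card (POI_gens k m) = 2 * k"
    using lower[OF fin generates_POI_gens[OF assms]] card_POI_gens by (intro antisym)
  then show ?thesis
    unfolding monoid_rank_def using lower fin generates_POI_gens[OF assms] by (intro Least_equality) blast+
qed

end
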